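(* Let $(\mathfrak g,J)$ be a non unimodular four dimensional Kähler Lie algebra with a pseudo-Kähler metric $g$ which is Ricci flat. Then $(\mathfrak g,J)$ is equivalent to one of $(\mathfrak r_{4,-1,-1},J)$, $(\mathfrak d_{4,2},J_1)$, $(\mathfrak{aff}(\mathbb C),J_2)$. Moreover, each of these three Lie algebras with complex structure has compatible pseudo-Kähler metrics which are flat, and also compatible pseudo-Kähler metrics which are Ricci flat but not flat.
   Context: All Lie algebras are real. $\mathfrak g$ is unimodular if $\operatorname{tr}(\operatorname{ad}_x)=0$ for all $x$. A complex structure is an endomorphism $J$ with $J^2=-I$ and $[Jx,Jy]-[x,y]-J[Jx,y]-J[x,Jy]=0$. A Kähler Lie algebra is a Lie algebra with a complex structure $J$ and a closed nondegenerate 2-form $\omega$ (closed: $\omega([x,y],z)+\omega([y,z],x)+\omega([z,x],y)=0$) with $\omega(Jx,Jy)=\omega(x,y)$; the associated (compatible) pseudo-Kähler metric is $g(x,y)=\omega(Jx,y)$, not necessarily definite. $(\mathfrak g_1,J)$ and $(\mathfrak g_2,J')$ are equivalent if there is a Lie algebra isomorphism $\alpha:\mathfrak g_1\to\mathfrak g_2$ with $J'\alpha=\alpha J$. The Levi-Civita connection is given by $2g(\nabla_xy,z)=g([x,y],z)-g([y,z],x)+g([z,x],y)$, the curvature by $R(x,y)=[\nabla_x,\nabla_y]-\nabla_{[x,y]}$, and the Ricci tensor by $ric(x,y)=-\sum_i\varepsilon_i\,g(R(x,v_i)y,v_i)$ for an orthonormal basis $\{v_i\}$, $\varepsilon_i=g(v_i,v_i)=\pm1$.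 Flat means $R\equiv0$; Ricci flat means $ric\equiv0$. In a basis $e_1,\dots,e_4$: $\mathfrak r_{4,-1,-1}$: $[e_4,e_1]=e_1$, $[e_4,e_2]=-e_2$, $[e_4,e_3]=-e_3$, with $Je_4=e_1$, $Je_2=e_3$. $\mathfrak d_{4,2}$: $[e_1,e_2]=e_3$, $[e_4,e_3]=e_3$, $[e_4,e_1]=2e_1$, $[e_4,e_2]=-e_2$, with $J_1e_4=-e_2$, $J_1e_1=e_3$. $\mathfrak{aff}(\mathbb C)$: $[e_1,e_3]=e_3$, $[e_1,e_4]=e_4$, $[e_2,e_3]=e_4$, $[e_2,e_4]=-e_3$, with $J_2e_1=-e_2$, $J_2e_3=e_4$. *)

theory Defs
  imports "HOL-Analysis.Analysis"
begin

text \<open>A Lie algebra is given by a bracket on the whole of a type of class \<^class>\<open>real_vector\<close>.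
  Finite dimension is not built in: the statement asks for \<^term>\<open>dim UNIV = 4\<close>, and an
  infinite-dimensional space has \<^term>\<open>dim\<close> equal to 0.\<close>

definition lie_algebra :: "('a::real_vector \<Rightarrow> 'a \<Rightarrow> 'a) \<Rightarrow> bool" where
  "lie_algebra br \<longleftrightarrow> bilinear br \<and> (\<forall>x. br x x = 0) \<and>
     (\<forall>x y z. br (br x y) z + br (br y z) x + br (br z x) y = 0)"

definition is_basis :: "'a::real_vector set \<Rightarrow> bool" where
  "is_basis B \<longleftrightarrow> finite B \<and> independent B \<and> span B = UNIV"

text \<open>The trace of an endomorphism of a finite-dimensional space: the sum of the diagonal entries
  of its matrix in some basis; \<open>lin_trace_eq\<close> below shows that every basis gives the same value.\<close>

definition lin_trace :: "('a::real_vector \<Rightarrow> 'a) \<Rightarrow> real" where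
  "lin_trace f = (let B = (SOME B. is_basis B) in \<Sum>b\<in>B. representation B (f b) b)"

definition unimodular :: "('a::real_vector \<Rightarrow> 'a \<Rightarrow> 'a) \<Rightarrow> bool" where
  "unimodular br \<longleftrightarrow> (\<forall>x. lin_trace (br x) = 0)"

definition complex_structure :: "('a::real_vector \<Rightarrow> 'a \<Rightarrow> 'a) \<Rightarrow> ('a \<Rightarrow> 'a) \<Rightarrow> bool" where
  "complex_structure br J \<longleftrightarrow> linear J \<and> (\<forall>x. J (J x) = - x) \<and>
     (\<forall>x y. br (J x) (J y) - br x y - J (br (J x) y) - J (br x (J y)) = 0)"

definition two_form :: "('a::real_vector \<Rightarrow> 'a \<Rightarrow> real) \<Rightarrow> bool" where
  "two_form \<omega> \<longleftrightarrow> bilinear \<omega> \<and> (\<forall>x. \<omega> x x = 0)"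

definition closed_form :: "('a::real_vector \<Rightarrow> 'a \<Rightarrow> 'a) \<Rightarrow> ('a \<Rightarrow> 'a \<Rightarrow> real) \<Rightarrow> bool" where
  "closed_form br \<omega> \<longleftrightarrow> (\<forall>x y z. \<omega> (br x y) z + \<omega> (br y z) x + \<omega> (br z x) y = 0)"

definition nondegenerate :: "('a::real_vector \<Rightarrow> 'a \<Rightarrow> real) \<Rightarrow> bool" where
  "nondegenerate \<omega> \<longleftrightarrow> (\<forall>x. (\<forall>y. \<omega> x y = 0) \<longrightarrow> x = 0)"

definition kaehler_lie_algebra ::
    "('a::real_vector \<Rightarrow> 'a \<Rightarrow> 'a) \<Rightarrow> ('a \<Rightarrow> 'a) \<Rightarrow> ('a \<Rightarrow> 'a \<Rightarrow> real) \<Rightarrow> bool" where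
  "kaehler_lie_algebra br J \<omega> \<longleftrightarrow> lie_algebra br \<and> complex_structure br J \<and>
     two_form \<omega> \<and> closed_form br \<omega> \<and> nondegenerate \<omega> \<and> (\<forall>x y. \<omega> (J x) (J y) = \<omega> x y)"

definition pseudo_kaehler_metric ::
    "('a::real_vector \<Rightarrow> 'a \<Rightarrow> 'a) \<Rightarrow> ('a \<Rightarrow> 'a) \<Rightarrow> ('a \<Rightarrow> 'a \<Rightarrow> real) \<Rightarrow> bool" where
  "pseudo_kaehler_metric br J g \<longleftrightarrow>
     (\<exists>\<omega>. kaehler_lie_algebra br J \<omega> \<and> g = (\<lambda>x y. \<omega> (J x) y))"

definition equivalent_complex ::
    "('a::real_vector \<Rightarrow> 'a \<Rightarrow> 'a) \<Rightarrow> ('a \<Rightarrow> 'a) \<Rightarrow>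
     ('b::real_vector \<Rightarrow> 'b \<Rightarrow> 'b) \<Rightarrow> ('b \<Rightarrow> 'b) \<Rightarrow> bool" where
  "equivalent_complex br J br' J' \<longleftrightarrow>
     (\<exists>\<alpha>. linear \<alpha> \<and> bij \<alpha> \<and> (\<forall>x y. \<alpha> (br x y) = br' (\<alpha> x) (\<alpha> y)) \<and> (\<forall>x. J' (\<alpha> x) = \<alpha> (J x)))"

text \<open>The vector \<open>\<nabla>\<^sub>x y\<close>, determined by the Koszul formula when \<open>g\<close> is nondegenerate on a
  finite-dimensional space.\<close>

definition levi_civita ::
    "('a::real_vector \<Rightarrow> 'a \<Rightarrow> 'a) \<Rightarrow> ('a \<Rightarrow> 'a \<Rightarrow> real) \<Rightarrow> 'a \<Rightarrow> 'a \<Rightarrow> 'a" where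
  "levi_civita br g x y =
     (THE w. \<forall>z. 2 * g w z = g (br x y) z - g (br y z) x + g (br z x) y)"

definition curvature ::
    "('a::real_vector \<Rightarrow> 'a \<Rightarrow> 'a) \<Rightarrow> ('a \<Rightarrow> 'a \<Rightarrow> real) \<Rightarrow> 'a \<Rightarrow> 'a \<Rightarrow> 'a \<Rightarrow> 'a" where
  "curvature br g x y z = (let D = levi_civita br g in D x (D y z) - D y (D x z) - D (br x y) z)"

definition orthonormal_basis :: "('a::real_vector \<Rightarrow> 'a \<Rightarrow> real) \<Rightarrow> 'a set \<Rightarrow> bool" where
  "orthonormal_basis g B \<longleftrightarrow> is_basis B \<and>
     (\<forall>u\<in>B. \<forall>v\<in>B. u \<noteq> v \<longrightarrow> g u v = 0) \<and> (\<forall>v\<in>B. g v v = 1 \<or> g v v = - 1)"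

text \<open>Again \<open>ricci_eq\<close> below shows that the choice of the orthonormal basis is irrelevant.\<close>

definition ricci ::
    "('a::real_vector \<Rightarrow> 'a \<Rightarrow> 'a) \<Rightarrow> ('a \<Rightarrow> 'a \<Rightarrow> real) \<Rightarrow> 'a \<Rightarrow> 'a \<Rightarrow> real" where
  "ricci br g x y = (let B = (SOME B. orthonormal_basis g B) in
     - (\<Sum>v\<in>B. g v v * g (curvature br g x v y) v))"

definition flat :: "('a::real_vector \<Rightarrow> 'a \<Rightarrow> 'a) \<Rightarrow> ('a \<Rightarrow> 'a \<Rightarrow> real) \<Rightarrow> bool" where
  "flat br g \<longleftrightarrow> (\<forall>x y z. curvature br g x y z = 0)"

definition ricci_flat :: "('a::real_vector \<Rightarrow> 'a \<Rightarrow> 'a) \<Rightarrow> ('a \<Rightarrow> 'a \<Rightarrow> real) \<Rightarrow> bool" where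
  "ricci_flat br g \<longleftrightarrow> (\<forall>x y. ricci br g x y = 0)"

text \<open>The three model algebras live on \<^typ>\<open>real^4\<close>. The index type \<^typ>\<open>4\<close> has the elements 1, 2, 3, 4
  (with 4 = 0). The brackets \<open>r4\<close>, \<open>d42\<close>, \<open>aff\<close> are those of \<open>r\<^bsub>4,-1,-1\<^esub>\<close>, \<open>d\<^bsub>4,2\<^esub>\<close>
  and \<open>aff(C)\<close>.\<close>

definition ee :: "4 \<Rightarrow> real^4" where
  "ee i = axis i 1"

text \<open>\<open>wedge i j\<close> is the alternating form \<open>e\<^sup>i \<and> e\<^sup>j\<close>: a bracket whose only nonzero values on basis
  vectors are \<open>[e\<^sub>i, e\<^sub>j] = v\<close> and \<open>[e\<^sub>j, e\<^sub>i] = - v\<close> is \<open>wedge i j x y *\<^sub>R v\<close>.\<close>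

definition wedge :: "4 \<Rightarrow> 4 \<Rightarrow> real^4 \<Rightarrow> real^4 \<Rightarrow> real" where
  "wedge i j x y = x$i * y$j - x$j * y$i"

definition r4_bracket :: "real^4 \<Rightarrow> real^4 \<Rightarrow> real^4" where
  "r4_bracket x y = wedge 4 1 x y *\<^sub>R ee 1 - wedge 4 2 x y *\<^sub>R ee 2 - wedge 4 3 x y *\<^sub>R ee 3"

text \<open>In each of the three complex structures the two values that are not prescribed follow from
  \<open>J\<^sup>2 = - I\<close>.\<close>

definition r4_J :: "real^4 \<Rightarrow> real^4" where
  "r4_J x = x$4 *\<^sub>R ee 1 - x$1 *\<^sub>R ee 4 + x$2 *\<^sub>R ee 3 - x$3 *\<^sub>R ee 2"

definition d42_bracket :: "real^4 \<Rightarrow> real^4 \<Rightarrow> real^4" where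
  "d42_bracket x y = wedge 1 2 x y *\<^sub>R ee 3 + wedge 4 3 x y *\<^sub>R ee 3 + wedge 4 1 x y *\<^sub>R (2 *\<^sub>R ee 1) - wedge 4 2 x y *\<^sub>R ee 2"

definition d42_J1 :: "real^4 \<Rightarrow> real^4" where
  "d42_J1 x = - x$4 *\<^sub>R ee 2 + x$2 *\<^sub>R ee 4 + x$1 *\<^sub>R ee 3 - x$3 *\<^sub>R ee 1"

definition aff_bracket :: "real^4 \<Rightarrow> real^4 \<Rightarrow> real^4" where
  "aff_bracket x y = wedge 1 3 x y *\<^sub>R ee 3 + wedge 1 4 x y *\<^sub>R ee 4 + wedge 2 3 x y *\<^sub>R ee 4 - wedge 2 4 x y *\<^sub>R ee 3"

definition aff_J2 :: "real^4 \<Rightarrow> real^4" where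
  "aff_J2 x = - x$1 *\<^sub>R ee 2 + x$2 *\<^sub>R ee 1 + x$3 *\<^sub>R ee 4 - x$4 *\<^sub>R ee 3"

lemmas model_defs = r4_bracket_def r4_J_def d42_bracket_def d42_J1_def aff_bracket_def aff_J2_def

lemma r4_table:
  "r4_bracket (ee 4) (ee 1) = ee 1" "r4_bracket (ee 4) (ee 2) = - ee 2" "r4_bracket (ee 4) (ee 3) = - ee 3"
  "r4_bracket (ee 1) (ee 2) = 0" "r4_bracket (ee 1) (ee 3) = 0" "r4_bracket (ee 2) (ee 3) = 0"
  "r4_J (ee 4) = ee 1" "r4_J (ee 2) = ee 3"
  by (simp_all add: model_defs vec_eq_iff wedge_def ee_def axis_def forall_4)

lemma d42_table:
  "d42_bracket (ee 1) (ee 2) = ee 3" "d42_bracket (ee 4) (ee 3) = ee 3"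
  "d42_bracket (ee 4) (ee 1) = 2 *\<^sub>R ee 1" "d42_bracket (ee 4) (ee 2) = - ee 2"
  "d42_bracket (ee 1) (ee 3) = 0" "d42_bracket (ee 2) (ee 3) = 0"
  "d42_J1 (ee 4) = - ee 2" "d42_J1 (ee 1) = ee 3"
  by (simp_all add: model_defs vec_eq_iff wedge_def ee_def axis_def forall_4)

lemma aff_table:
  "aff_bracket (ee 1) (ee 3) = ee 3" "aff_bracket (ee 1) (ee 4) = ee 4"
  "aff_bracket (ee 2) (ee 3) = ee 4" "aff_bracket (ee 2) (ee 4) = - ee 3"
  "aff_bracket (ee 1) (ee 2) = 0" "aff_bracket (ee 3) (ee 4) = 0"
  "aff_J2 (ee 1) = - ee 2" "aff_J2 (ee 3) = ee 4"
  by (simp_all add: model_defs vec_eq_iff wedge_def ee_def axis_def forall_4)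

lemma lie_algebra_models:
  "lie_algebra r4_bracket" "lie_algebra d42_bracket" "lie_algebra aff_bracket"
  by (auto simp: lie_algebra_def bilinear_def model_defs vec_eq_iff wedge_def ee_def axis_def forall_4
      algebra_simps intro!: linearI)

lemma complex_structure_models:
  "complex_structure r4_bracket r4_J" "complex_structure d42_bracket d42_J1"
  "complex_structure aff_bracket aff_J2"
  by (auto simp: complex_structure_def model_defs vec_eq_iff wedge_def ee_def axis_def forall_4
      algebra_simps intro!: linearI)

lemma lin_trace_eq:
  fixes f :: "'a::real_vector \<Rightarrow> 'a"
  assumes f: "linear f" and B: "is_basis B"
  shows "lin_trace f = (\<Sum>b\<in>B. representation B (f b) b)"
proof -
  define C :: "'a set" where "C = (SOME B. is_basis B)"
  have C: "is_basis C" unfolding C_def using B by (rule someI)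
  have expand: "representation D (f v) d = (\<Sum>b\<in>E. representation E v b * representation D (f b) d)"
    if "is_basis D" "is_basis E" for D E :: "'a set" and v d
  proof -
    have "f v = f (\<Sum>b\<in>E. representation E v b *\<^sub>R b)"
      using that by (subst real_vector.sum_representation_eq) (auto simp: is_basis_def)
    also have "\<dots> = (\<Sum>b\<in>E. representation E v b *\<^sub>R f b)"
      using f by (simp add: linear_sum linear_cmul)
    finally show ?thesis
      using that by (simp add: real_vector.representation_sum real_vector.representation_scale is_basis_def)
  qed
  have change: "representation D v d = (\<Sum>b\<in>E. representation E v b * representation D b d)"
    if "is_basis D" "is_basis E" for D E :: "'a set" and v d
  proof -
    have "v = (\<Sum>b\<in>E. representation E v b *\<^sub>R b)"
      using that by (subst real_vector.sum_representation_eq) (auto simp: is_basis_def)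
    then have "representation D v d = representation D (\<Sum>b\<in>E. representation E v b *\<^sub>R b) d"
      by simp
    also have "\<dots> = (\<Sum>b\<in>E. representation E v b * representation D b d)"
      using that by (simp add: real_vector.representation_sum real_vector.representation_scale is_basis_def)
    finally show ?thesis .
  qed
  have "lin_trace f = (\<Sum>c\<in>C. representation C (f c) c)"
    by (simp add: lin_trace_def C_def Let_def)
  also have "\<dots> = (\<Sum>c\<in>C. \<Sum>b\<in>B. representation B c b * representation C (f b) c)"
    by (rule sum.cong[OF refl]) (rule expand[OF C B])
  also have "\<dots> = (\<Sum>b\<in>B. \<Sum>c\<in>C. representation C (f b) c * representation B c b)"
    by (subst sum.swap) (simp add: mult.commute)
  also have "\<dots> = (\<Sum>b\<in>B. representation B (f b) b)"
    by (rule sum.cong[OF refl]) (rule change[OF B C, symmetric])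
  finally show ?thesis .
qed

context
  fixes g :: "'a::real_vector \<Rightarrow> 'a \<Rightarrow> real" and B :: "'a set"
  assumes g: "bilinear g" and B: "orthonormal_basis g B"
begin

lemma orthonormal_expand: "z = (\<Sum>v\<in>B. representation B z v *\<^sub>R v)"
  using B by (subst real_vector.sum_representation_eq) (auto simp: orthonormal_basis_def is_basis_def)

lemma orthonormal_sum_delta:
  assumes "u \<in> B"
  shows "(\<Sum>v\<in>B. c v * g v u) = c u * g u u" "(\<Sum>v\<in>B. c v * g u v) = c u * g u u"
proof -
  have fin: "finite B" using B by (simp add: orthonormal_basis_def is_basis_def)
  have "(\<Sum>v\<in>B. c v * g v u) = (\<Sum>v\<in>B. if v = u then c u * g u u else 0)"
    using B assms by (intro sum.cong) (auto simp: orthonormal_basis_def)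
  then show "(\<Sum>v\<in>B. c v * g v u) = c u * g u u" using fin assms by simp
  have "(\<Sum>v\<in>B. c v * g u v) = (\<Sum>v\<in>B. if v = u then c u * g u u else 0)"
    using B assms by (intro sum.cong) (auto simp: orthonormal_basis_def)
  then show "(\<Sum>v\<in>B. c v * g u v) = c u * g u u" using fin assms by simp
qed

lemma orthonormal_sq: "v \<in> B \<Longrightarrow> g v v * g v v = 1"
  using B by (auto simp: orthonormal_basis_def)

lemma bilinear_sum_left: "g (\<Sum>v\<in>A. c v *\<^sub>R h v) z = (\<Sum>v\<in>A. c v * g (h v) z)"
proof -
  have "linear (\<lambda>x. g x z)" using g by (simp add: bilinear_def)
  then show ?thesis by (simp add: linear_sum[where f = "\<lambda>x. g x z"] linear_cmul[where f = "\<lambda>x. g x z"])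
qed

lemma bilinear_sum_right: "g z (\<Sum>v\<in>A. c v *\<^sub>R h v) = (\<Sum>v\<in>A. c v * g z (h v))"
proof -
  have "linear (\<lambda>x. g z x)" using g by (simp add: bilinear_def)
  then show ?thesis by (simp add: linear_sum[where f = "\<lambda>x. g z x"] linear_cmul[where f = "\<lambda>x. g z x"])
qed

lemma representation_orthonormal:
  assumes "v \<in> B" shows "representation B z v = g v v * g z v"
proof -
  have "g z v = (\<Sum>u\<in>B. representation B z u * g u v)"
    by (subst orthonormal_expand[of z]) (rule bilinear_sum_left)
  also have "\<dots> = representation B z v * g v v"
    by (rule orthonormal_sum_delta(1)[OF assms])
  finally show ?thesis using orthonormal_sq[OF assms] by (simp add: mult.left_commute)
qed

lemma orthonormal_ext:
  assumes "\<And>v. v \<in> B \<Longrightarrow> g x v = g y v" shows "x = y"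
proof -
  have "(\<Sum>v\<in>B. representation B x v *\<^sub>R v) = (\<Sum>v\<in>B. representation B y v *\<^sub>R v)"
    using assms by (intro sum.cong) (simp_all add: representation_orthonormal)
  then show ?thesis using orthonormal_expand[of x] orthonormal_expand[of y] by simp
qed

lemma orthonormal_riesz:
  assumes "linear L" shows "\<exists>!x. \<forall>z. g x z = L z"
proof -
  have *: "g (\<Sum>v\<in>B. (g v v * L v) *\<^sub>R v) z = L z" for z
  proof -
    have "g (\<Sum>v\<in>B. (g v v * L v) *\<^sub>R v) z = (\<Sum>v\<in>B. (g v v * L v) * g v z)"
      by (rule bilinear_sum_left)
    also have "\<dots> = (\<Sum>v\<in>B. representation B z v * L v)"
    proof (rule sum.cong[OF refl])
      fix v assume v: "v \<in> B"
      have "g v z = (\<Sum>u\<in>B. representation B z u * g v u)"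
        by (subst orthonormal_expand[of z]) (rule bilinear_sum_right)
      also have "\<dots> = representation B z v * g v v"
        by (rule orthonormal_sum_delta(2)[OF v])
      finally show "g v v * L v * g v z = representation B z v * L v"
        using orthonormal_sq[OF v] by (simp add: algebra_simps)
    qed
    also have "\<dots> = L (\<Sum>v\<in>B. representation B z v *\<^sub>R v)"
      using assms by (simp add: linear_sum linear_cmul)
    also have "\<dots> = L z" using orthonormal_expand[of z] by simp
    finally show ?thesis .
  qed
  show ?thesis
  proof (rule ex1I)
    show "\<forall>z. g (\<Sum>v\<in>B. (g v v * L v) *\<^sub>R v) z = L z" using * by blast
  next
    fix y assume "\<forall>z. g y z = L z"
    then show "y = (\<Sum>v\<in>B. (g v v * L v) *\<^sub>R v)"
      using * by (intro orthonormal_ext) simp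
  qed
qed

lemma levi_civita_koszul:
  assumes br: "bilinear br"
  shows "2 * g (levi_civita br g x y) z = g (br x y) z - g (br y z) x + g (br z x) y"
proof -
  let ?L = "\<lambda>z. (g (br x y) z - g (br y z) x + g (br z x) y) / 2"
  have "linear ?L"
    by (rule linearI)
      (simp_all add: bilinear_ladd[OF br] bilinear_radd[OF br] bilinear_ladd[OF g] bilinear_radd[OF g]
        bilinear_lmul[OF br] bilinear_rmul[OF br] bilinear_lmul[OF g] bilinear_rmul[OF g]
        algebra_simps add_divide_distrib diff_divide_distrib)
  from orthonormal_riesz[OF this]
  have "\<exists>!w. \<forall>z. 2 * g w z = g (br x y) z - g (br y z) x + g (br z x) y"
    by (simp add: field_simps)
  from theI'[OF this] show ?thesis by (simp add: levi_civita_def)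
qed

lemma bilinear_levi_civita:
  assumes br: "bilinear br" shows "bilinear (levi_civita br g)"
proof -
  note K = levi_civita_koszul[OF br]
  note lin = bilinear_ladd[OF br] bilinear_radd[OF br] bilinear_ladd[OF g] bilinear_radd[OF g]
    bilinear_lmul[OF br] bilinear_rmul[OF br] bilinear_lmul[OF g] bilinear_rmul[OF g]
  have eqI: "p = q" if "\<And>z. 2 * g p z = 2 * g q z" for p q
    using that by (intro orthonormal_ext) simp
  have "levi_civita br g x (y + y') = levi_civita br g x y + levi_civita br g x y'" for x y y'
    by (rule eqI) (simp add: K lin distrib_left)
  moreover have "levi_civita br g x (c *\<^sub>R y) = c *\<^sub>R levi_civita br g x y" for x y c
  proof (rule eqI)
    fix z
    have "2 * g (c *\<^sub>R levi_civita br g x y) z = c * (2 * g (levi_civita br g x y) z)"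
      by (simp add: lin)
    then show "2 * g (levi_civita br g x (c *\<^sub>R y)) z = 2 * g (c *\<^sub>R levi_civita br g x y) z"
      by (simp only: K) (simp add: lin algebra_simps)
  qed
  moreover have "levi_civita br g (x + x') y = levi_civita br g x y + levi_civita br g x' y" for x x' y
    by (rule eqI) (simp add: K lin distrib_left)
  moreover have "levi_civita br g (c *\<^sub>R x) y = c *\<^sub>R levi_civita br g x y" for x y c
  proof (rule eqI)
    fix z
    have "2 * g (c *\<^sub>R levi_civita br g x y) z = c * (2 * g (levi_civita br g x y) z)"
      by (simp add: lin)
    then show "2 * g (levi_civita br g (c *\<^sub>R x) y) z = 2 * g (c *\<^sub>R levi_civita br g x y) z"
      by (simp only: K) (simp add: lin algebra_simps)
  qed
  ultimately show ?thesis by (auto simp: bilinear_def intro!: linearI)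
qed

lemma ricci_trace:
  assumes br: "bilinear br"
  shows "- (\<Sum>v\<in>B. g v v * g (curvature br g x v y) v) = - lin_trace (\<lambda>v. curvature br g x v y)"
proof -
  note D = bilinear_levi_civita[OF br]
  have "linear (\<lambda>v. curvature br g x v y)"
    by (rule linearI)
      (simp_all add: curvature_def Let_def bilinear_ladd[OF br] bilinear_radd[OF br] bilinear_ladd[OF D]
        bilinear_radd[OF D] bilinear_lmul[OF br] bilinear_rmul[OF br] bilinear_lmul[OF D]
        bilinear_rmul[OF D] algebra_simps)
  moreover have "is_basis B" using B by (simp add: orthonormal_basis_def)
  ultimately show ?thesis by (simp add: lin_trace_eq representation_orthonormal)
qed

end

lemma ricci_eq:
  assumes "bilinear br" "bilinear g" "orthonormal_basis g B"
  shows "ricci br g x y = - (\<Sum>v\<in>B. g v v * g (curvature br g x v y) v)"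
proof -
  have "orthonormal_basis g (SOME B. orthonormal_basis g B)" using assms(3) by (rule someI)
  from ricci_trace[OF assms(2) this assms(1)] ricci_trace[OF assms(2,3,1)]
  show ?thesis by (simp add: ricci_def Let_def)
qed

end

theory Submission
  imports Defs
begin

text \<open>
  Two linear functionals govern the proof: \<open>\<xi>(x) = tr(ad\<^sub>x)\<close> and
  \<open>\<eta>(x) = tr(J ad\<^sub>x) - tr(ad\<^bsub>Jx\<^esub>)\<close>. Closedness of \<open>\<omega>\<close> and integrability of \<open>J\<close> make \<open>J\<close>
  parallel, so that \<open>\<eta>(x) = tr(J \<nabla>\<^sub>x)\<close>; by the Bianchi identity the Ricci form is, up to a factor,
  \<open>\<eta>([x,y])\<close>. Hence a Ricci flat metric forces \<open>\<eta>\<close> to vanish on commutators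
  (\<open>ricci_flat_eta\<close>), a condition on the bracket and \<open>J\<close> alone.

  Non-unimodularity means \<open>\<xi> \<noteq> 0\<close>. Choose \<open>f\<close> with \<open>\<xi>(f) = 0\<close> and \<open>\<xi>(Jf) = 1\<close>, and \<open>e\<close> spanning the
  complex line \<open>D\<close> on which \<open>\<xi>\<close> and \<open>\<xi> \<circ> J\<close> vanish. All commutators lie in the kernel of \<open>\<xi>\<close>, the real
  span of \<open>D\<close> and \<open>f\<close>. Identify \<open>D\<close> with the complex numbers by \<open>z \<mapsto> Re z e + Im z Je\<close>.
  Integrability and the values of \<open>\<xi>\<close> on the basis reduce the bracket to
  \<open>[e,Je] = w + s f\<close>, \<open>[f,x] = i\<gamma> x - i b x\<^sup>* + \<lambda>(x) f\<close>, \<open>[Jf,x] = a x + b x\<^sup>* - \<lambda>(Jx) f\<close>,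
  \<open>[Jf,f] = v + t f\<close>, where \<open>x\<close> is in \<open>D\<close>, \<open>x\<^sup>*\<close> is its complex conjugate, \<open>\<lambda>(x) = Im (x\<^sup>* w)\<close> and
  \<open>a = (1 - t)/2 + i\<tau>\<close> (\<open>bracket_table\<close>).

  Ricci flatness now says that either \<open>s = w = t = 0\<close> or \<open>t = - 2\<gamma> - 1\<close>. In the second case the Jacobi
  identity gives \<open>s = w = 0\<close> as well, so \<open>D\<close> is an abelian ideal. Closedness of \<open>\<omega>\<close> makes \<open>D\<close> isotropic, and
  nondegeneracy then yields \<open>\<bar>(1 + t)/2 - \<gamma> + i\<tau>\<bar>\<^sup>2 = 4 \<bar>b\<bar>\<^sup>2\<close> (\<open>kaehler_equation\<close>). With the rest of
  the Jacobi identity only three values of the parameters survive (\<open>parameter_cases\<close>). Moving \<open>f\<close> by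
  an element of \<open>D\<close> removes \<open>v\<close>, a rotation of \<open>e\<close> makes \<open>b\<close> real and positive when it is nonzero, and the
  three tables that result are those of the three models.

  Conversely, on each model the value of \<open>\<omega>\<close> on the complex line of \<open>f\<close> is a free parameter \<open>k\<close>. The
  curvature turns out to be \<open>R(x,y)z = k \<phi>(x,y) N z\<close> with \<open>\<phi>(x, N z) = 0\<close>: it vanishes exactly for
  \<open>k = 0\<close>, and the Ricci tensor, the trace of a rank one map, vanishes for all \<open>k\<close>.
\<close>

section \<open>Traces and bases\<close>

lemma representation_linear_image:
  fixes f :: "'a::real_vector \<Rightarrow> 'a"
  assumes f: "linear f" and B: "is_basis B"
  shows "representation B (f v) d = (\<Sum>b\<in>B. representation B v b * representation B (f b) d)"
proof -
  have "f v = f (\<Sum>b\<in>B. representation B v b *\<^sub>R b)"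
    using B by (subst real_vector.sum_representation_eq) (auto simp: is_basis_def)
  also have "\<dots> = (\<Sum>b\<in>B. representation B v b *\<^sub>R f b)"
    using f by (simp add: linear_sum linear_cmul)
  finally show ?thesis
    using B by (simp add: real_vector.representation_sum real_vector.representation_scale is_basis_def)
qed

lemma linear_diff_fun: "linear f \<Longrightarrow> linear g \<Longrightarrow> linear (\<lambda>x. f x - g x :: 'a::real_vector)"
  by (rule linearI) (simp_all add: linear_add linear_cmul algebra_simps)

lemma lin_trace_add:
  fixes B :: "'a::real_vector set" and f :: "'a \<Rightarrow> 'a"
  assumes "is_basis B" "linear f" "linear g"
  shows "lin_trace (\<lambda>x. f x + g x) = lin_trace f + lin_trace g"
proof -
  have "linear (\<lambda>x. f x + g x)"
    using assms by (intro linearI) (simp_all add: linear_add linear_cmul algebra_simps)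
  with assms show ?thesis
    by (simp add: lin_trace_eq[OF _ assms(1)]) (simp add: is_basis_def real_vector.representation_add sum.distrib)
qed

lemma lin_trace_diff:
  fixes B :: "'a::real_vector set" and f :: "'a \<Rightarrow> 'a"
  assumes "is_basis B" "linear f" "linear g"
  shows "lin_trace (\<lambda>x. f x - g x) = lin_trace f - lin_trace g"
  using assms linear_diff_fun[OF assms(2,3)]
  by (simp add: lin_trace_eq[OF _ assms(1)]) (simp add: is_basis_def real_vector.representation_diff sum_subtractf)

lemma lin_trace_cmul:
  fixes B :: "'a::real_vector set" and f :: "'a \<Rightarrow> 'a"
  assumes "is_basis B" "linear f"
  shows "lin_trace (\<lambda>x. c *\<^sub>R f x) = c * lin_trace f"
proof -
  have "linear (\<lambda>x. c *\<^sub>R f x)"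
    using assms by (intro linearI) (simp_all add: linear_add linear_cmul algebra_simps)
  with assms show ?thesis
    by (simp add: lin_trace_eq[OF _ assms(1)]) (simp add: is_basis_def real_vector.representation_scale sum_distrib_left)
qed

lemma lin_trace_comm:
  fixes B :: "'a::real_vector set" and f g :: "'a \<Rightarrow> 'a"
  assumes B: "is_basis B" and f: "linear f" and g: "linear g"
  shows "lin_trace (\<lambda>x. f (g x)) = lin_trace (\<lambda>x. g (f x))"
proof -
  have fg: "linear (\<lambda>x. f (g x))" "linear (\<lambda>x. g (f x))"
    using f g linear_compose[of g f] linear_compose[of f g] by (simp_all add: o_def)
  have "lin_trace (\<lambda>x. f (g x))
      = (\<Sum>d\<in>B. \<Sum>b\<in>B. representation B (g d) b * representation B (f b) d)"
    by (simp add: lin_trace_eq[OF fg(1) B] representation_linear_image[OF f B, of "g _"])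
  also have "\<dots> = (\<Sum>d\<in>B. \<Sum>b\<in>B. representation B (f d) b * representation B (g b) d)"
    by (subst sum.swap) (simp add: mult.commute)
  also have "\<dots> = lin_trace (\<lambda>x. g (f x))"
    by (simp add: lin_trace_eq[OF fg(2) B] representation_linear_image[OF g B, of "f _"])
  finally show ?thesis .
qed

lemma lin_trace_rank_one:
  fixes B :: "'a::real_vector set" and u :: 'a
  assumes B: "is_basis B" and \<phi>: "linear \<phi>"
  shows "lin_trace (\<lambda>v. \<phi> v *\<^sub>R u) = \<phi> u"
proof -
  have "linear (\<lambda>v. \<phi> v *\<^sub>R u)"
    using \<phi> by (intro linearI) (simp_all add: linear_add linear_cmul scaleR_left_distrib)
  then have "lin_trace (\<lambda>v. \<phi> v *\<^sub>R u) = (\<Sum>b\<in>B. representation B u b * \<phi> b)"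
    using B by (simp add: lin_trace_eq) (simp add: real_vector.representation_scale is_basis_def mult.commute)
  also have "\<dots> = \<phi> (\<Sum>b\<in>B. representation B u b *\<^sub>R b)"
    using \<phi> by (simp add: linear_sum linear_cmul)
  also have "(\<Sum>b\<in>B. representation B u b *\<^sub>R b) = u"
    using B by (intro real_vector.sum_representation_eq) (auto simp: is_basis_def)
  finally show ?thesis .
qed

text \<open>The type is not assumed finite-dimensional, so this familiar fact has to come from the exchange
  lemma, with the finite basis that a positive dimension provides.\<close>

lemma independent_card_dim_spans:
  fixes B :: "'a::real_vector set"
  assumes ind: "independent B" and card: "card B = dim (UNIV :: 'a set)" and pos: "card B > 0"
  shows "is_basis B"
proof -
  have finB: "finite B" by (rule card_ge_0_finite) (rule pos)
  obtain C :: "'a set" where C: "independent C" "UNIV \<subseteq> span C" "card C = dim (UNIV :: 'a set)"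
    by (rule real_vector.basis_exists[of "UNIV :: 'a set"])
  have finC: "finite C" using C(3) card pos by (intro card_ge_0_finite) simp
  have "x \<in> span B" for x
  proof (rule ccontr)
    assume x: "x \<notin> span B"
    then have "x \<notin> B" by (meson span_base)
    with x ind have "independent (insert x B)" by (simp add: independent_insert)
    then have "card (insert x B) \<le> card C"
      using real_vector.independent_span_bound[OF finC, of "insert x B"] C(2) by auto
    with \<open>x \<notin> B\<close> finB C(3) card show False by simp
  qed
  with ind finB show ?thesis by (auto simp: is_basis_def)
qed

lemma card_four_distinct:
  assumes "card {a, b, c, d} = 4"
  shows "a \<noteq> b" "a \<noteq> c" "a \<noteq> d" "b \<noteq> c" "b \<noteq> d" "c \<noteq> d"
  using assms by (auto simp: card_insert_if split: if_splits)

text \<open>A complex basis \<open>e, f\<close> of a complex plane, seen as the real basis \<open>e, Je, f, Jf\<close>. The four dual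
  coordinates turn each vector identity into four real equations.\<close>

locale complex_frame =
  fixes J :: "'a::real_vector \<Rightarrow> 'a" and e f :: 'a
  assumes frame_linear: "linear J" and frame_square: "J (J x) = - x"
    and frame_basis: "is_basis {e, J e, f, J f}" and frame_card: "card {e, J e, f, J f} = 4"
begin

definition c1 :: "'a \<Rightarrow> real" where "c1 x = representation {e, J e, f, J f} x e"
definition c2 :: "'a \<Rightarrow> real" where "c2 x = representation {e, J e, f, J f} x (J e)"
definition c3 :: "'a \<Rightarrow> real" where "c3 x = representation {e, J e, f, J f} x f"
definition c4 :: "'a \<Rightarrow> real" where "c4 x = representation {e, J e, f, J f} x (J f)"

lemmas coord_defs = c1_def c2_def c3_def c4_def

lemmas frame_distinct = card_four_distinct[OF frame_card]

lemma frame_sum: "(\<Sum>b\<in>{e, J e, f, J f}. h b) = h e + h (J e) + h f + h (J f)" for h :: "'a \<Rightarrow> 'b::comm_monoid_add"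
  using frame_distinct by (simp add: add.assoc)

lemma coord_linear: "linear c1" "linear c2" "linear c3" "linear c4"
  using frame_basis unfolding coord_defs is_basis_def
  by (auto intro!: linearI simp: real_vector.representation_add real_vector.representation_scale)

lemmas coord_simps [simp] = coord_linear[THEN linear_add] coord_linear[THEN linear_diff]
  coord_linear[THEN linear_neg] coord_linear[THEN linear_cmul] coord_linear[THEN linear_0]

lemma coord_basis [simp]:
  "c1 e = 1" "c2 e = 0" "c3 e = 0" "c4 e = 0"
  "c1 (J e) = 0" "c2 (J e) = 1" "c3 (J e) = 0" "c4 (J e) = 0"
  "c1 f = 0" "c2 f = 0" "c3 f = 1" "c4 f = 0"
  "c1 (J f) = 0" "c2 (J f) = 0" "c3 (J f) = 0" "c4 (J f) = 1"
  using frame_basis frame_distinct frame_distinct[symmetric] unfolding coord_defs is_basis_def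
  by (simp_all add: real_vector.representation_basis)

lemma coord_expand: "x = c1 x *\<^sub>R e + c2 x *\<^sub>R J e + c3 x *\<^sub>R f + c4 x *\<^sub>R J f"
proof -
  have "(\<Sum>b\<in>{e, J e, f, J f}. representation {e, J e, f, J f} x b *\<^sub>R b) = x"
    using frame_basis by (intro real_vector.sum_representation_eq) (auto simp: is_basis_def)
  then show ?thesis unfolding frame_sum by (simp add: coord_defs)
qed

lemma coord_eqI: "c1 x = c1 y \<Longrightarrow> c2 x = c2 y \<Longrightarrow> c3 x = c3 y \<Longrightarrow> c4 x = c4 y \<Longrightarrow> x = y"
  using coord_expand[of x] coord_expand[of y] by simp

lemma coord_J [simp]: "c1 (J x) = - c2 x" "c2 (J x) = c1 x" "c3 (J x) = - c4 x" "c4 (J x) = c3 x"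
proof -
  have "J x = c1 x *\<^sub>R J e - c2 x *\<^sub>R e + c3 x *\<^sub>R J f - c4 x *\<^sub>R f"
    by (subst coord_expand[of x])
      (simp add: linear_add[OF frame_linear] linear_cmul[OF frame_linear] frame_square)
  then show "c1 (J x) = - c2 x" "c2 (J x) = c1 x" "c3 (J x) = - c4 x" "c4 (J x) = c3 x"
    by (simp_all only: coord_simps coord_basis) simp_all
qed

lemma frame_nonzero: "e \<noteq> 0"
proof
  assume "e = 0"
  then have "c1 e = c1 0" by (rule arg_cong)
  then show False by simp
qed

text \<open>A nonzero vector of the complex line spanned by \<open>e\<close> can be completed to a frame by any vector with a
  component along \<open>f\<close>; this validates every later change of frame.\<close>

lemma not_in_line: "x \<notin> span {u, J u}" if "c3 u = 0" "c4 u = 0" "c3 x \<noteq> 0"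
proof
  assume "x \<in> span {u, J u}"
  then obtain a b where "x - a *\<^sub>R u = b *\<^sub>R J u"
    by (auto simp: span_breakdown_eq span_singleton)
  then have "c3 (x - a *\<^sub>R u) = c3 (b *\<^sub>R J u)" by simp
  with that show False by simp
qed

lemma trace_frame:
  "linear h \<Longrightarrow> lin_trace h = c1 (h e) + c2 (h (J e)) + c3 (h f) + c4 (h (J f))"
  by (simp only: lin_trace_eq[OF _ frame_basis] frame_sum) (simp add: coord_defs)

end

lemma complex_frameI:
  fixes J :: "'a::real_vector \<Rightarrow> 'a"
  assumes dim: "dim (UNIV :: 'a set) = 4" and J: "linear J" and JJ: "\<And>x. J (J x) = - x"
    and e: "e \<noteq> 0" and f: "f \<notin> span {e, J e}"
  shows "complex_frame J e f"
proof -
  let ?S = "span {e, J e}"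
  have 1: "J e \<notin> span {e}"
  proof
    assume "J e \<in> span {e}"
    then obtain k where k: "J e = k *\<^sub>R e" by (auto simp: span_singleton)
    then have "- e = k *\<^sub>R k *\<^sub>R e" using JJ[of e] by (metis J linear_cmul)
    then have "(1 + k * k) *\<^sub>R e = 0" by (simp add: scaleR_left_distrib neg_eq_iff_add_eq_0)
    moreover have "1 + k * k \<noteq> 0" by (smt (verit) zero_le_square)
    ultimately show False using e by simp
  qed
  have J_span: "J x \<in> ?S" if "x \<in> ?S" for x
  proof -
    have "J ` ?S = span (J ` {e, J e})" using J by (metis linear_span_image)
    also have "\<dots> \<subseteq> ?S"
      by (rule span_minimal) (auto simp: JJ span_neg span_base)
    finally show ?thesis using that by auto
  qed
  \<comment> \<open>If \<open>Jf = k f\<close> modulo the complex line of \<open>e\<close>, applying \<open>J\<close> once more gives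
      \<open>(1 + k\<^sup>2) f = 0\<close> modulo that line.\<close>
  have 2: "J f \<notin> span {f, J e, e}"
  proof
    assume "J f \<in> span {f, J e, e}"
    then obtain k where k: "J f - k *\<^sub>R f \<in> ?S"
      by (metis span_breakdown_eq insert_commute)
    from J_span[OF k] have "- f - k *\<^sub>R J f \<in> ?S"
      by (simp add: linear_diff[OF J] linear_cmul[OF J] JJ)
    from span_add[OF this span_scale[OF k, of k]] have "- ((1 + k * k) *\<^sub>R f) \<in> ?S"
      by (simp add: algebra_simps)
    then have "(1 / (1 + k * k)) *\<^sub>R (1 + k * k) *\<^sub>R f \<in> ?S"
      by (metis span_neg span_scale add.inverse_inverse)
    moreover have "1 + k * k \<noteq> 0" by (smt (verit) zero_le_square)
    ultimately show False using f by simp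
  qed
  have ind: "independent {J f, f, J e, e}"
  proof -
    have "f \<notin> span {J e, e}" using f by (simp add: insert_commute[of "J e" e])
    with e 1 2 show ?thesis by (simp add: independent_insert)
  qed
  have "J e \<noteq> e" "f \<noteq> e" "f \<noteq> J e" "J f \<noteq> e" "J f \<noteq> J e" "J f \<noteq> f"
    using 1 2 f span_base[of "J e" "{e}"] span_base[of f "{e, J e}"] span_base[of "J f" "{f, J e, e}"]
    by auto
  then have "card {J f, f, J e, e} = 4" by simp
  with ind dim have "is_basis {J f, f, J e, e}" "card {J f, f, J e, e} = 4"
    by (auto intro: independent_card_dim_spans)
  moreover have "{J f, f, J e, e} = {e, J e, f, J f}" by auto
  ultimately show ?thesis using J JJ by (intro complex_frame.intro) simp_all
qed

lemma exists_outside_complex_line: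
  fixes J :: "'a::real_vector \<Rightarrow> 'a"
  assumes dim: "dim (UNIV :: 'a set) = 4"
  shows "\<exists>y. y \<notin> span {e, J e}"
proof (rule ccontr)
  assume "\<not> ?thesis"
  then have "dim (UNIV :: 'a set) \<le> card {e, J e}"
    by (intro real_vector.dim_le_card) auto
  with dim show False by (simp add: card_insert_if split: if_splits)
qed


section \<open>The Ricci form of a pseudo-Kaehler Lie algebra\<close>

locale kaehler4 =
  fixes br :: "'a::real_vector \<Rightarrow> 'a \<Rightarrow> 'a" and J :: "'a \<Rightarrow> 'a" and \<omega> :: "'a \<Rightarrow> 'a \<Rightarrow> real"
  assumes dim4: "dim (UNIV :: 'a set) = 4" and kaehler: "kaehler_lie_algebra br J \<omega>"
begin

abbreviation (input) g where "g \<equiv> (\<lambda>x y. \<omega> (J x) y)"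
abbreviation (input) nabla where "nabla \<equiv> levi_civita br g"

lemma br_bilinear: "bilinear br" and br_self: "br x x = 0"
  and jacobi: "br (br x y) z + br (br y z) x + br (br z x) y = 0"
  and linear_J: "linear J" and J_J: "J (J x) = - x"
  and nijenhuis: "br (J x) (J y) - br x y - J (br (J x) y) - J (br x (J y)) = 0"
  and omega_bilinear: "bilinear \<omega>" and omega_self: "\<omega> x x = 0"
  and omega_closed: "\<omega> (br x y) z + \<omega> (br y z) x + \<omega> (br z x) y = 0"
  and omega_nondegenerate: "(\<And>y. \<omega> x y = 0) \<Longrightarrow> x = 0"
  and omega_J_J: "\<omega> (J x) (J y) = \<omega> x y"
  using kaehler
  by (auto simp: kaehler_lie_algebra_def lie_algebra_def complex_structure_def two_form_def
      closed_form_def nondegenerate_def)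

lemmas br_simps = bilinear_ladd[OF br_bilinear] bilinear_radd[OF br_bilinear]
  bilinear_lsub[OF br_bilinear] bilinear_rsub[OF br_bilinear]
  bilinear_lneg[OF br_bilinear] bilinear_rneg[OF br_bilinear]
  bilinear_lmul[OF br_bilinear] bilinear_rmul[OF br_bilinear]
  bilinear_lzero[OF br_bilinear] bilinear_rzero[OF br_bilinear]

lemmas omega_simps = bilinear_ladd[OF omega_bilinear] bilinear_radd[OF omega_bilinear]
  bilinear_lsub[OF omega_bilinear] bilinear_rsub[OF omega_bilinear]
  bilinear_lneg[OF omega_bilinear] bilinear_rneg[OF omega_bilinear]
  bilinear_lmul[OF omega_bilinear] bilinear_rmul[OF omega_bilinear]
  bilinear_lzero[OF omega_bilinear] bilinear_rzero[OF omega_bilinear] real_scaleR_def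

lemmas J_simps = linear_add[OF linear_J] linear_diff[OF linear_J] linear_neg[OF linear_J]
  linear_cmul[OF linear_J] linear_0[OF linear_J] J_J

lemma br_skew: "br x y = - br y x"
proof -
  have "br x y + br y x = 0" using br_self[of "x + y"] unfolding br_simps by (simp add: br_self add.commute)
  then show ?thesis by (simp add: eq_neg_iff_add_eq_0)
qed

lemma omega_skew: "\<omega> x y = - \<omega> y x"
  using omega_self[of "x + y"] unfolding omega_simps by (simp add: omega_self)

lemma omega_J_left: "\<omega> (J x) y = - \<omega> x (J y)"
  using omega_J_J[of x "J y"] by (simp add: J_simps omega_simps)

lemma g_sym: "\<omega> (J x) y = \<omega> (J y) x"
  using omega_J_left[of x y] omega_skew[of x "J y"] by simp

lemma g_bilinear: "bilinear g"
  unfolding bilinear_def by (auto intro!: linearI simp: J_simps omega_simps)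

lemma omega_ext:
  assumes "\<And>z. \<omega> x z = \<omega> y z" shows "x = y"
  using omega_nondegenerate[of "x - y"] assms by (simp add: omega_simps)

lemma frame: "e \<noteq> 0 \<Longrightarrow> f \<notin> span {e, J e} \<Longrightarrow> complex_frame J e f"
  by (rule complex_frameI[OF dim4 linear_J J_J])

lemma unit_vector:
  assumes "\<omega> (J u) u \<noteq> 0"
  shows "\<exists>c. \<omega> (J (c *\<^sub>R u)) (c *\<^sub>R u) \<in> {1, - 1}"
proof
  let ?c = "1 / sqrt \<bar>\<omega> (J u) u\<bar>"
  have "?c * ?c = 1 / \<bar>\<omega> (J u) u\<bar>" using assms by simp
  then have "\<omega> (J (?c *\<^sub>R u)) (?c *\<^sub>R u) = \<omega> (J u) u / \<bar>\<omega> (J u) u\<bar>"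
    unfolding J_simps omega_simps by (simp only: mult.assoc[symmetric]) simp
  then show "\<omega> (J (?c *\<^sub>R u)) (?c *\<^sub>R u) \<in> {1, - 1}"
    using assms by (auto simp: abs_if)
qed

lemma polarize:
  "\<omega> (J (x + y)) (x + y) = \<omega> (J x) x + 2 * \<omega> (J x) y + \<omega> (J y) y"
  by (simp add: J_simps omega_simps g_sym[of y x])

text \<open>The metric is \<open>J\<close>-invariant and \<open>g(u, Ju) = \<omega>(Ju, Ju) = 0\<close>, so a unit vector \<open>u\<close> always comes with
  the orthogonal unit vector \<open>Ju\<close>. It remains to find a nonnull vector orthogonal to both; if there
  were none, polarization would make the orthogonal complement totally isotropic and \<open>g\<close> degenerate.\<close>

lemma exists_orthonormal_basis: "\<exists>B. orthonormal_basis g B"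
proof -
  have "\<exists>x::'a. x \<noteq> 0"
    using exists_outside_complex_line[OF dim4, of 0 J] by (metis span_zero)
  then obtain x :: 'a where "x \<noteq> 0" by blast
  then obtain y where "\<omega> (J x) (J y) \<noteq> 0" using omega_nondegenerate[of x] omega_J_J by metis
  with polarize[of x "J y"] have "\<omega> (J (x + J y)) (x + J y) \<noteq> 0 \<or> \<omega> (J x) x \<noteq> 0 \<or> \<omega> (J (J y)) (J y) \<noteq> 0"
    by linarith
  then obtain u0 where "\<omega> (J u0) u0 \<noteq> 0" by metis
  from unit_vector[OF this] obtain u where u: "\<omega> (J u) u \<in> {1, - 1}" by blast
  \<comment> \<open>The orthogonal projection along the complex line of \<open>u\<close>; note \<open>g(Ju, z) = - \<omega>(u, z)\<close>.\<close>
  define p where "p z = z - (\<omega> (J u) u * \<omega> (J u) z) *\<^sub>R u - (\<omega> (J u) u * \<omega> u z) *\<^sub>R (- J u)" for z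
  note simps = J_simps omega_simps omega_self omega_J_J omega_skew[of u "J u"]
  have p_orth: "\<omega> (J u) (p z) = 0" "\<omega> u (p z) = 0" for z
    using u by (auto simp: p_def simps)
  have uu: "u \<noteq> 0" using u by (auto simp: simps)
  have p_zero: "z \<in> span {u, J u}" if "p z = 0" for z
  proof -
    have "z = (\<omega> (J u) u * \<omega> (J u) z) *\<^sub>R u + (\<omega> (J u) u * \<omega> u z) *\<^sub>R (- J u)"
      using that by (simp add: p_def algebra_simps)
    also have "\<dots> \<in> span {u, J u}"
      by (intro span_add span_scale span_neg) (auto intro: span_base)
    finally show ?thesis .
  qed
  have p_add: "p (z + z') = p z + p z'" for z z'
    by (simp add: p_def simps algebra_simps)
  have "\<exists>z. \<omega> (J (p z)) (p z) \<noteq> 0"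
  proof (rule ccontr)
    assume "\<nexists>z. \<omega> (J (p z)) (p z) \<noteq> 0"
    then have null: "\<omega> (J (p z)) (p z) = 0" for z by blast
    have iso: "\<omega> (J (p z)) (p z') = 0" for z z'
      using polarize[of "p z" "p z'"] null[of "z + z'"] null[of z] null[of z'] by (simp add: p_add)
    obtain z where z: "z \<notin> span {u, J u}" using exists_outside_complex_line[OF dim4] by blast
    have "\<omega> (J (p z)) y = 0" for y
    proof -
      have "\<omega> (J (p z)) y = \<omega> (J (p z)) (p y + (\<omega> (J u) u * \<omega> (J u) y) *\<^sub>R u + (\<omega> (J u) u * \<omega> u y) *\<^sub>R (- J u))"
        by (simp add: p_def)
      also have "\<dots> = \<omega> (J (p z)) (p y) + (\<omega> (J u) u * \<omega> (J u) y) * \<omega> (J (p z)) u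
          - (\<omega> (J u) u * \<omega> u y) * \<omega> (J (p z)) (J u)"
        by (simp add: omega_simps)
      also have "\<dots> = 0"
        using p_orth[of z] iso[of z y] omega_skew[of u "p z"] by (simp add: g_sym[of "p z" u] simps)
      finally show ?thesis .
    qed
    then have "J (p z) = 0" by (rule omega_nondegenerate)
    then have "p z = 0" using J_J[of "p z"] by (simp add: J_simps)
    with p_zero z show False by blast
  qed
  then obtain z where z: "\<omega> (J (p z)) (p z) \<noteq> 0" by blast
  from unit_vector[OF z] obtain c where c: "\<omega> (J (c *\<^sub>R p z)) (c *\<^sub>R p z) \<in> {1, - 1}" by blast
  define v where "v = c *\<^sub>R p z"
  have v: "\<omega> (J v) v \<in> {1, - 1}" "\<omega> (J u) v = 0" "\<omega> u v = 0"
    using c p_orth[of z] by (auto simp: v_def simps)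
  have "v \<notin> span {u, J u}"
  proof
    assume "v \<in> span {u, J u}"
    then obtain a b where "v - a *\<^sub>R u = b *\<^sub>R J u"
      by (auto simp: span_breakdown_eq span_singleton)
    then have "v = a *\<^sub>R u + b *\<^sub>R J u" by (simp add: algebra_simps)
    then show False using v u by (auto simp: simps)
  qed
  then interpret complex_frame J u v by (rule frame[OF uu])
  have "\<omega> v u = 0" "\<omega> (J v) u = 0" "\<omega> (J v) (J u) = 0" "\<omega> v (J u) = 0" "\<omega> u (J v) = 0" 
    using v omega_skew[of v u] g_sym[of v u] omega_skew[of v "J u"] omega_J_left[of u v] by (simp_all add: simps)
  then have "orthonormal_basis g {u, J u, v, J v}"
    using u v frame_basis by (auto simp: orthonormal_basis_def simps omega_skew[of v "J v"])
  then show ?thesis by blast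
qed

lemma koszul:
  "2 * \<omega> (J (nabla x y)) z = \<omega> (J (br x y)) z - \<omega> (J (br y z)) x + \<omega> (J (br z x)) y"
proof -
  obtain B where "orthonormal_basis g B" using exists_orthonormal_basis by blast
  from levi_civita_koszul[OF g_bilinear this br_bilinear] show ?thesis by simp
qed

lemma nabla_bilinear: "bilinear nabla"
proof -
  obtain B where "orthonormal_basis g B" using exists_orthonormal_basis by blast
  from bilinear_levi_civita[OF g_bilinear this br_bilinear] show ?thesis by simp
qed

lemmas nabla_simps = bilinear_ladd[OF nabla_bilinear] bilinear_radd[OF nabla_bilinear]
  bilinear_lsub[OF nabla_bilinear] bilinear_rsub[OF nabla_bilinear]
  bilinear_lneg[OF nabla_bilinear] bilinear_rneg[OF nabla_bilinear]
  bilinear_lmul[OF nabla_bilinear] bilinear_rmul[OF nabla_bilinear]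

lemma g_ext:
  assumes "\<And>z. 2 * \<omega> (J x) z = 2 * \<omega> (J y) z" shows "x = y"
proof -
  have "J x = J y" using assms by (intro omega_ext) simp
  then have "J (J x) = J (J y)" by simp
  then show ?thesis by (simp add: J_J)
qed

lemma levi_civita_eqI:
  assumes "\<And>z. 2 * \<omega> (J w) z = \<omega> (J (br x y)) z - \<omega> (J (br y z)) x + \<omega> (J (br z x)) y"
  shows "nabla x y = w"
  by (rule g_ext) (simp only: koszul assms)

lemma torsion_free: "nabla x y - nabla y x = br x y"
proof (rule g_ext)
  fix z
  have "2 * \<omega> (J (nabla x y - nabla y x)) z = 2 * \<omega> (J (nabla x y)) z - 2 * \<omega> (J (nabla y x)) z"
    by (simp add: J_simps omega_simps)
  also have "\<dots> = 2 * \<omega> (J (br x y)) z"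
    unfolding koszul br_skew[of y x] br_skew[of x z] br_skew[of z y]
    by (simp add: J_simps omega_simps)
  finally show "2 * \<omega> (J (nabla x y - nabla y x)) z = 2 * \<omega> (J (br x y)) z" .
qed

lemma nabla_metric: "\<omega> (J (nabla x y)) z + \<omega> (J (nabla x z)) y = 0"
proof -
  have "2 * \<omega> (J (nabla x y)) z + 2 * \<omega> (J (nabla x z)) y = 0"
    unfolding koszul br_skew[of y x] br_skew[of x z] br_skew[of z y]
    by (simp add: J_simps omega_simps)
  then show ?thesis by linarith
qed

text \<open>The parallelism of \<open>J\<close> is the Koszul formula rewritten with the Nijenhuis identity for \<open>y, z\<close>:
  what remains is the difference of the closedness identities for \<open>x, y, z\<close> and for \<open>x, Jy, Jz\<close>.\<close>

lemma nabla_J: "nabla x (J y) = J (nabla x y)"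
proof (rule g_ext)
  fix z
  have N: "J (br (J y) z) + J (br y (J z)) = br (J y) (J z) - br y z"
    using nijenhuis[of y z] by (simp add: algebra_simps)
  have "\<omega> (J (br (J y) z)) x + \<omega> (J (br y (J z))) x = \<omega> (br (J y) (J z)) x - \<omega> (br y z) x"
    by (simp only: omega_simps[symmetric] N)
  then have "2 * \<omega> (J (nabla x (J y))) z + 2 * \<omega> (J (nabla x y)) (J z) = 0"
    unfolding koszul using omega_closed[of x y z] omega_closed[of x "J y" "J z"]
      omega_J_left[of "br x (J y)" z] omega_J_left[of "br (J z) x" y]
    by (simp add: omega_J_J)
  then show "2 * \<omega> (J (nabla x (J y))) z = 2 * \<omega> (J (J (nabla x y))) z"
    by (simp add: omega_J_left[of "J (nabla x y)" z])
qed

abbreviation (input) R where "R \<equiv> curvature br g"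

lemma curvature_J: "R x y (J z) = J (R x y z)"
  by (simp add: curvature_def Let_def nabla_J J_simps)

lemma curvature_skew: "R y x z = - R x y z"
  by (simp add: curvature_def Let_def br_skew[of y x] nabla_simps)

lemma bianchi: "R x y z + R y z x + R z x y = 0"
proof -
  have "R x y z + R y z x + R z x y
      = (nabla x (nabla y z - nabla z y) - nabla (br y z) x)
      + (nabla y (nabla z x - nabla x z) - nabla (br z x) y)
      + (nabla z (nabla x y - nabla y x) - nabla (br x y) z)"
    by (simp add: curvature_def Let_def nabla_simps)
  also have "\<dots> = br x (br y z) + br y (br z x) + br z (br x y)"
    by (simp only: torsion_free)
  also have "\<dots> = - (br (br x y) z + br (br y z) x + br (br z x) y)"
    using br_skew[of x "br y z"] br_skew[of y "br z x"] br_skew[of z "br x y"] by simp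
  finally show ?thesis by (simp add: jacobi)
qed

lemma linear_nabla: "linear (nabla x)" "linear (\<lambda>y. nabla y x)"
  and linear_br: "linear (br x)" "linear (\<lambda>y. br y x)"
  using nabla_bilinear br_bilinear by (simp_all add: bilinear_def)

lemma linear_J_comp: "linear h \<Longrightarrow> linear (\<lambda>x. J (h x))"
  using linear_compose[OF _ linear_J] by (simp add: o_def)

lemma exists_basis: "\<exists>B :: 'a set. is_basis B"
  using exists_orthonormal_basis by (auto simp: orthonormal_basis_def)

text \<open>\<open>\<nabla>\<^sub>x\<close> is skew for the metric, so its diagonal entries in an orthonormal basis vanish.\<close>

lemma trace_nabla: "lin_trace (nabla x) = 0"
proof -
  obtain B where B: "orthonormal_basis g B" using exists_orthonormal_basis by blast
  then have "is_basis B" by (simp add: orthonormal_basis_def)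
  then have "lin_trace (nabla x) = (\<Sum>b\<in>B. \<omega> (J b) b * \<omega> (J (nabla x b)) b)"
    using representation_orthonormal[OF g_bilinear B] by (simp add: lin_trace_eq linear_nabla)
  also have "\<dots> = 0" using nabla_metric[of x b b for b] by simp
  finally show ?thesis .
qed

text \<open>This is a potential of the Ricci form: the latter is a multiple of \<open>eta \<circ> br\<close>.\<close>

definition eta :: "'a \<Rightarrow> real" where
  "eta x = lin_trace (\<lambda>y. J (br x y)) - lin_trace (br (J x))"

text \<open>Torsion-freeness, used twice, and \<open>\<nabla>J = 0\<close> give
  \<open>J \<nabla>\<^sub>x y = J [x,y] - [Jx,y] + \<nabla>\<^bsub>Jx\<^esub> y\<close>; the last term is traceless.\<close>

lemma eta_nabla: "eta x = lin_trace (\<lambda>y. J (nabla x y))"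
proof -
  obtain B :: "'a set" where B: "is_basis B" using exists_basis by blast
  have "J (nabla x y) = (J (br x y) - br (J x) y) + nabla (J x) y" for y
  proof -
    have "J (nabla x y) = J (br x y) + nabla y (J x)"
      by (simp add: torsion_free[of x y, symmetric] nabla_J J_simps)
    also have "nabla y (J x) = nabla (J x) y - br (J x) y"
      using torsion_free[of "J x" y] by (simp add: algebra_simps)
    finally show ?thesis by simp
  qed
  then have "lin_trace (\<lambda>y. J (nabla x y)) = lin_trace (\<lambda>y. (J (br x y) - br (J x) y) + nabla (J x) y)"
    by simp
  also have "\<dots> = lin_trace (\<lambda>y. J (br x y) - br (J x) y) + lin_trace (nabla (J x))"
    by (rule lin_trace_add[OF B]) (intro linear_diff_fun linear_J_comp linear_br linear_nabla)+
  also have "lin_trace (\<lambda>y. J (br x y) - br (J x) y) = eta x"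
    unfolding eta_def by (rule lin_trace_diff[OF B]) (intro linear_J_comp linear_br)+
  finally show ?thesis by (simp add: trace_nabla)
qed

lemma ricci_eq_trace: "ricci br g x y = - lin_trace (\<lambda>v. R x v y)"
proof -
  obtain B where B: "orthonormal_basis g B" using exists_orthonormal_basis by blast
  from ricci_eq[OF br_bilinear g_bilinear B] ricci_trace[OF g_bilinear B br_bilinear]
  show ?thesis by simp
qed

lemma linear_curvature: "linear (\<lambda>v. R x v y)" "linear (R x y)"
  by (rule linearI; simp add: curvature_def Let_def nabla_simps br_simps algebra_simps)+

text \<open>By the Bianchi identity and \<open>\<nabla>J = 0\<close>, \<open>R(x,v)Jy - R(y,v)Jx = J R(x,y)v\<close>. The traces over \<open>v\<close> of
  the terms on the left are Ricci curvatures, hence \<open>tr(J R(x,y)) = 0\<close>. As \<open>J\<close> commutes with \<open>\<nabla>\<close>,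
  the commutator part of \<open>R(x,y)\<close> contributes no trace, and \<open>tr(J \<nabla>\<^bsub>[x,y]\<^esub>) = 0\<close> is left.\<close>

lemma ricci_flat_eta:
  assumes "ricci_flat br g" shows "eta (br x y) = 0"
proof -
  obtain B :: "'a set" where B: "is_basis B" using exists_basis by blast
  have T: "lin_trace (\<lambda>v. R x v y) = 0" for x y
    using assms ricci_eq_trace[of x y] by (simp add: ricci_flat_def)
  have "R x v (J y) = R y v (J x) + J (R x y v)" for v
  proof -
    have "R x v y = R y v x + R x y v"
      using bianchi[of x v y] curvature_skew[of y x v] curvature_skew[of v y x]
      by (simp add: algebra_simps add_eq_0_iff)
    then show ?thesis by (simp add: curvature_J J_simps)
  qed
  then have "lin_trace (\<lambda>v. R x v (J y)) = lin_trace (\<lambda>v. R y v (J x) + J (R x y v))" by simp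
  also have "\<dots> = lin_trace (\<lambda>v. R y v (J x)) + lin_trace (\<lambda>v. J (R x y v))"
    by (rule lin_trace_add[OF B linear_curvature(1) linear_J_comp[OF linear_curvature(2)]])
  finally have "0 = lin_trace (\<lambda>v. J (R x y v))" by (simp add: T)
  also have "(\<lambda>v. J (R x y v))
      = (\<lambda>v. (J (nabla x (nabla y v)) - nabla y (J (nabla x v))) - J (nabla (br x y) v))"
    by (simp add: curvature_def Let_def J_simps nabla_J)
  also have "lin_trace \<dots> = lin_trace (\<lambda>v. J (nabla x (nabla y v)) - nabla y (J (nabla x v)))
      - lin_trace (\<lambda>v. J (nabla (br x y) v))"
    using linear_compose[OF linear_nabla(1)[of x] linear_nabla(1)[of y]]
      linear_compose[OF linear_nabla(1)[of y] linear_nabla(1)[of x]]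
      linear_compose[OF linear_J_comp[OF linear_nabla(1)[of x]] linear_nabla(1)[of y]]
    by (intro lin_trace_diff[OF B] linear_diff_fun linear_J_comp linear_nabla) (simp_all add: o_def)
  also have "lin_trace (\<lambda>v. J (nabla x (nabla y v)) - nabla y (J (nabla x v)))
     = lin_trace (\<lambda>v. J (nabla x (nabla y v))) - lin_trace (\<lambda>v. nabla y (J (nabla x v)))"
    using linear_compose[OF linear_nabla(1)[of y] linear_nabla(1)[of x]]
      linear_compose[OF linear_J_comp[OF linear_nabla(1)[of x]] linear_nabla(1)[of y]]
    by (intro lin_trace_diff[OF B] linear_J_comp) (simp_all add: o_def)
  also have "\<dots> = 0"
    using lin_trace_comm[OF B linear_J_comp[OF linear_nabla(1)[of x]] linear_nabla(1)[of y]] by simp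
  finally show ?thesis by (simp add: eta_nabla)
qed

text \<open>The Jacobi identity makes \<open>ad\<^bsub>[x,y]\<^esub>\<close> a commutator of endomorphisms.\<close>

lemma trace_ad_bracket: "lin_trace (br (br x y)) = 0"
proof -
  obtain B :: "'a set" where B: "is_basis B" using exists_basis by blast
  have "br (br x y) z = br x (br y z) - br y (br x z)" for z
  proof -
    have "br (br z x) y = br y (br x z)"
      by (subst br_skew, subst br_skew[of z x]) (simp add: br_simps)
    with jacobi[of x y z] br_skew[of "br y z" x] show ?thesis by (simp add: algebra_simps add_eq_0_iff)
  qed
  then have "br (br x y) = (\<lambda>z. br x (br y z) - br y (br x z))" by blast
  then have "lin_trace (br (br x y)) = lin_trace (\<lambda>z. br x (br y z) - br y (br x z))" by simp
  also have "\<dots> = lin_trace (\<lambda>z. br x (br y z)) - lin_trace (\<lambda>z. br y (br x z))"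
    using linear_compose[OF linear_br(1)[of y] linear_br(1)[of x]]
      linear_compose[OF linear_br(1)[of x] linear_br(1)[of y]]
    by (intro lin_trace_diff[OF B]) (simp_all add: o_def)
  also have "\<dots> = 0" using lin_trace_comm[OF B linear_br(1)[of x] linear_br(1)[of y]] by simp
  finally show ?thesis .
qed

lemma linear_trace_ad: "linear (\<lambda>x. lin_trace (br x))"
proof -
  obtain B :: "'a set" where B: "is_basis B" using exists_basis by blast
  show ?thesis
  proof (rule linearI)
  show "lin_trace (br (x + y)) = lin_trace (br x) + lin_trace (br y)" for x y
  proof -
    have "br (x + y) = (\<lambda>z. br x z + br y z)" by (auto simp: br_simps)
    then show ?thesis by (simp add: lin_trace_add[OF B] linear_br)
  qed
  show "lin_trace (br (k *\<^sub>R x)) = k *\<^sub>R lin_trace (br x)" for k x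
  proof -
    have "br (k *\<^sub>R x) = (\<lambda>z. k *\<^sub>R br x z)" by (auto simp: br_simps)
    then show ?thesis by (simp add: lin_trace_cmul[OF B] linear_br)
  qed
qed
qed

end

section \<open>Recognising the three models\<close>

lemma vector_4 [simp]:
  fixes w x y z :: "'a::zero"
  shows "(vector [w, x, y, z] :: 'a^4) $ 1 = w" "(vector [w, x, y, z] :: 'a^4) $ 2 = x"
    "(vector [w, x, y, z] :: 'a^4) $ 3 = y" "(vector [w, x, y, z] :: 'a^4) $ 4 = z"
  unfolding vector_def by simp_all

locale kaehler_frame = kaehler4 br J \<omega> + complex_frame J e f
  for br :: "'a::real_vector \<Rightarrow> 'a \<Rightarrow> 'a" and J :: "'a \<Rightarrow> 'a" and \<omega> :: "'a \<Rightarrow> 'a \<Rightarrow> real"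
    and e f :: 'a
begin

lemma br_expand: "br x y =
    (c1 x * c2 y - c2 x * c1 y) *\<^sub>R br e (J e)
  + (c3 x * c1 y - c1 x * c3 y) *\<^sub>R br f e + (c3 x * c2 y - c2 x * c3 y) *\<^sub>R br f (J e)
  + (c4 x * c1 y - c1 x * c4 y) *\<^sub>R br (J f) e + (c4 x * c2 y - c2 x * c4 y) *\<^sub>R br (J f) (J e)
  + (c4 x * c3 y - c3 x * c4 y) *\<^sub>R br (J f) f"
proof -
  have "br x y = br (c1 x *\<^sub>R e + c2 x *\<^sub>R J e + c3 x *\<^sub>R f + c4 x *\<^sub>R J f)
      (c1 y *\<^sub>R e + c2 y *\<^sub>R J e + c3 y *\<^sub>R f + c4 y *\<^sub>R J f)"
    using coord_expand[of x] coord_expand[of y] by simp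
  then show ?thesis
    by (simp add: br_simps br_self br_skew[of "J e" e] br_skew[of e f] br_skew[of "J e" f]
        br_skew[of e "J f"] br_skew[of "J e" "J f"] br_skew[of f "J f"] algebra_simps)
qed

text \<open>In this and the next two lemmas the isomorphism is read off from the position of \<open>e\<close>, \<open>f\<close> in the
  model. Here \<open>e\<^sub>1 = f\<close>, \<open>e\<^sub>2 = e\<close>, \<open>e\<^sub>3 = Je\<close>, \<open>e\<^sub>4 = - Jf\<close>, and the sign turns the eigenvalues
  \<open>1, 1, - 1\<close> of \<open>ad\<^bsub>Jf\<^esub>\<close> into \<open>- 1, - 1, 1\<close>.\<close>

lemma equivalent_r4:
  assumes "br e (J e) = 0" "br f e = 0" "br f (J e) = 0"
    and "br (J f) e = e" "br (J f) (J e) = J e" "br (J f) f = - f"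
  shows "equivalent_complex br J r4_bracket r4_J"
  unfolding equivalent_complex_def
proof (intro exI conjI allI)
  let ?\<alpha> = "\<lambda>x. vector [c3 x, c1 x, c2 x, - c4 x] :: real^4"
  show "linear ?\<alpha>" by (rule linearI) (simp_all add: vec_eq_iff forall_4)
  show "bij ?\<alpha>"
  proof (rule bijI)
    show "inj ?\<alpha>" by (rule injI) (auto simp: vec_eq_iff forall_4 intro!: coord_eqI)
    show "surj ?\<alpha>"
      by (rule surjI[where f = "\<lambda>y. y$2 *\<^sub>R e + y$3 *\<^sub>R J e + y$1 *\<^sub>R f - y$4 *\<^sub>R J f"])
        (simp add: vec_eq_iff forall_4)
  qed
  show "?\<alpha> (br x y) = r4_bracket (?\<alpha> x) (?\<alpha> y)" for x y
    unfolding br_expand[of x y] assms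
    by (simp add: model_defs vec_eq_iff forall_4 wedge_def ee_def axis_def)
  show "r4_J (?\<alpha> x) = ?\<alpha> (J x)" for x
    by (simp add: model_defs vec_eq_iff forall_4 ee_def axis_def)
qed

text \<open>Here \<open>e\<^sub>1 = e\<close>, \<open>e\<^sub>2 = 2f\<close>, \<open>e\<^sub>3 = Je\<close>, \<open>e\<^sub>4 = 2Jf\<close>: the normalisation \<open>tr(ad\<^bsub>Jf\<^esub>) = 1\<close> is half of
  the trace 2 of \<open>ad e\<^sub>4\<close>.\<close>

lemma equivalent_d42:
  assumes "br e (J e) = 0" "br f e = - (1/2) *\<^sub>R J e" "br f (J e) = 0"
    and "br (J f) e = e" "br (J f) (J e) = (1/2) *\<^sub>R J e" "br (J f) f = - (1/2) *\<^sub>R f"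
  shows "equivalent_complex br J d42_bracket d42_J1"
  unfolding equivalent_complex_def
proof (intro exI conjI allI)
  let ?\<alpha> = "\<lambda>x. vector [c1 x, c3 x / 2, c2 x, c4 x / 2] :: real^4"
  show "linear ?\<alpha>" by (rule linearI) (simp_all add: vec_eq_iff forall_4 add_divide_distrib)
  show "bij ?\<alpha>"
  proof (rule bijI)
    show "inj ?\<alpha>" by (rule injI) (auto simp: vec_eq_iff forall_4 intro!: coord_eqI)
    show "surj ?\<alpha>"
      by (rule surjI[where f = "\<lambda>y. y$1 *\<^sub>R e + y$3 *\<^sub>R J e + (2 * y$2) *\<^sub>R f + (2 * y$4) *\<^sub>R J f"])
        (simp add: vec_eq_iff forall_4)
  qed
  show "?\<alpha> (br x y) = d42_bracket (?\<alpha> x) (?\<alpha> y)" for x y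
    unfolding br_expand[of x y] assms
    by (simp add: model_defs vec_eq_iff forall_4 wedge_def ee_def axis_def field_simps)
  show "d42_J1 (?\<alpha> x) = ?\<alpha> (J x)" for x
    by (simp add: model_defs vec_eq_iff forall_4 ee_def axis_def)
qed

text \<open>Here \<open>e\<^sub>1 = 2Jf\<close>, \<open>e\<^sub>2 = 2f\<close>, \<open>e\<^sub>3 = e\<close>, \<open>e\<^sub>4 = Je\<close>, with the same factor 2.\<close>

lemma equivalent_aff:
  assumes "br e (J e) = 0" "br f e = (1/2) *\<^sub>R J e" "br f (J e) = - (1/2) *\<^sub>R e"
    and "br (J f) e = (1/2) *\<^sub>R e" "br (J f) (J e) = (1/2) *\<^sub>R J e" "br (J f) f = 0"
  shows "equivalent_complex br J aff_bracket aff_J2"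
  unfolding equivalent_complex_def
proof (intro exI conjI allI)
  let ?\<alpha> = "\<lambda>x. vector [c4 x / 2, c3 x / 2, c1 x, c2 x] :: real^4"
  show "linear ?\<alpha>" by (rule linearI) (simp_all add: vec_eq_iff forall_4 add_divide_distrib)
  show "bij ?\<alpha>"
  proof (rule bijI)
    show "inj ?\<alpha>" by (rule injI) (auto simp: vec_eq_iff forall_4 intro!: coord_eqI)
    show "surj ?\<alpha>"
      by (rule surjI[where f = "\<lambda>y. y$3 *\<^sub>R e + y$4 *\<^sub>R J e + (2 * y$2) *\<^sub>R f + (2 * y$1) *\<^sub>R J f"])
        (simp add: vec_eq_iff forall_4)
  qed
  show "?\<alpha> (br x y) = aff_bracket (?\<alpha> x) (?\<alpha> y)" for x y
    unfolding br_expand[of x y] assms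
    by (simp add: model_defs vec_eq_iff forall_4 wedge_def ee_def axis_def field_simps)
  show "aff_J2 (?\<alpha> x) = ?\<alpha> (J x)" for x
    by (simp add: model_defs vec_eq_iff forall_4 ee_def axis_def)
qed

end

section \<open>Structure equations in an adapted frame\<close>

text \<open>The traces say that \<open>c4\<close> is the functional \<open>x \<mapsto> tr(ad\<^sub>x)\<close>, so that all brackets lie in the real
  span of \<open>e, Je, f\<close>. The vector \<open>f\<close> is determined up to the complex line of \<open>e\<close>.\<close>

locale adapted_frame = kaehler_frame +
  assumes trace_e: "lin_trace (br e) = 0" and trace_Je: "lin_trace (br (J e)) = 0"
    and trace_f: "lin_trace (br f) = 0" and trace_Jf: "lin_trace (br (J f)) = 1"
    and eta_bracket: "eta (br x y) = 0"
begin

lemma trace_ad: "lin_trace (br x) = c4 x"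
proof -
  have "lin_trace (br x) = lin_trace (br (c1 x *\<^sub>R e + c2 x *\<^sub>R J e + c3 x *\<^sub>R f + c4 x *\<^sub>R J f))"
    using coord_expand[of x] by simp
  then show ?thesis
    by (simp add: linear_add[OF linear_trace_ad] linear_cmul[OF linear_trace_ad]
        trace_e trace_Je trace_f trace_Jf)
qed

lemma c4_br [simp]: "c4 (br x y) = 0"
  using trace_ad_bracket[of x y] trace_ad[of "br x y"] by simp

text \<open>The real and imaginary parts of \<open>w, b, v\<close>, and the real parameters \<open>s, \<gamma>, \<tau>, t\<close>; they are the
  coefficients that the trace and Nijenhuis equations below leave free.\<close>

definition "w1 = c1 (br e (J e))"
definition "w2 = c2 (br e (J e))"
definition "s = c3 (br e (J e))"
definition "\<gamma> = (c2 (br f e) - c1 (br f (J e))) / 2"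
definition "b1 = - (c2 (br f e) + c1 (br f (J e))) / 2"
definition "b2 = c1 (br f e)"
definition "\<tau> = c2 (br (J f) e) - b2"
definition "v1 = c1 (br (J f) f)"
definition "v2 = c2 (br (J f) f)"
definition "t = c3 (br (J f) f)"

lemmas param_defs = w1_def w2_def s_def \<gamma>_def b1_def b2_def \<tau>_def v1_def v2_def t_def

text \<open>The diagonal of \<open>ad\<^sub>x\<close> in the frame, for \<open>x\<close> equal to \<open>e, Je, f, Jf\<close>.\<close>

lemma trace_equations:
  "c2 (br e (J e)) = c3 (br f e)" "c1 (br e (J e)) = - c3 (br f (J e))"
  "c1 (br f e) + c2 (br f (J e)) = 0"
  "c1 (br (J f) e) + c2 (br (J f) (J e)) + c3 (br (J f) f) = 1"
  using trace_e trace_Je trace_f trace_Jf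
  by (simp_all add: trace_frame linear_br br_self br_skew[of "J e" e] br_skew[of e f] br_skew[of "J e" f])

text \<open>In real dimension four the Nijenhuis tensor is determined by its value on \<open>f, e\<close>.\<close>

lemma nijenhuis_equations:
  "c1 (br (J f) (J e)) - c1 (br f e) + c2 (br (J f) e) + c2 (br f (J e)) = 0"
  "c2 (br (J f) (J e)) - c2 (br f e) - c1 (br (J f) e) - c1 (br f (J e)) = 0"
  "c3 (br (J f) (J e)) = c3 (br f e)" "c3 (br (J f) e) = - c3 (br f (J e))"
  using arg_cong[OF nijenhuis[of f e], of c1] arg_cong[OF nijenhuis[of f e], of c2]
    arg_cong[OF nijenhuis[of f e], of c3] arg_cong[OF nijenhuis[of f e], of c4]
  by simp_all

lemma bracket_table:
  "br e (J e) = w1 *\<^sub>R e + w2 *\<^sub>R J e + s *\<^sub>R f"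
  "br f e = b2 *\<^sub>R e + (\<gamma> - b1) *\<^sub>R J e + w2 *\<^sub>R f"
  "br f (J e) = (- \<gamma> - b1) *\<^sub>R e - b2 *\<^sub>R J e - w1 *\<^sub>R f"
  "br (J f) e = ((1 - t) / 2 + b1) *\<^sub>R e + (\<tau> + b2) *\<^sub>R J e + w1 *\<^sub>R f"
  "br (J f) (J e) = (b2 - \<tau>) *\<^sub>R e + ((1 - t) / 2 - b1) *\<^sub>R J e + w2 *\<^sub>R f"
  "br (J f) f = v1 *\<^sub>R e + v2 *\<^sub>R J e + t *\<^sub>R f"
  using trace_equations nijenhuis_equations
  by (auto intro!: coord_eqI simp: param_defs field_simps)

lemma eta_coord: "eta x = - (2 * \<gamma> + t + 1) * c3 x - 2 * \<tau> * c4 x"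
proof -
  have "eta x = c1 (J (br x e)) + c2 (J (br x (J e))) + c3 (J (br x f)) + c4 (J (br x (J f))) - c4 (J x)"
    unfolding eta_def trace_ad by (simp add: trace_frame linear_J_comp linear_br)
  then show ?thesis
    unfolding br_expand[of x e] br_expand[of x "J e"] br_expand[of x f] br_expand[of x "J f"] bracket_table
    by (simp add: algebra_simps)
qed

text \<open>Only multiples of \<open>f\<close> contribute to \<open>\<eta>\<close> on commutators: if the coefficient there is nonzero, no
  commutator has a component along \<open>f\<close>.\<close>

lemma eta_cases: "s = 0 \<and> w1 = 0 \<and> w2 = 0 \<and> t = 0 \<or> t = - 2 * \<gamma> - 1"
proof (cases "2 * \<gamma> + t + 1 = 0")
  case False
  with eta_bracket eta_coord have "c3 (br x y) = 0" for x y by (metis c4_br mult_eq_0_iff neg_equal_0_iff_equal mult_zero_right diff_zero)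
  from this[of e "J e"] this[of f e] this[of f "J e"] this[of "J f" f] show ?thesis
    by (simp add: bracket_table)
qed linarith

lemmas jacobi_expand = br_simps br_self bracket_table br_skew[of "J e" e] br_skew[of e f] br_skew[of "J e" f]
        br_skew[of e "J f"] br_skew[of "J e" "J f"] br_skew[of f "J f"]

text \<open>In complex notation: \<open>2\<bar>w\<bar>\<^sup>2 = s (1 - 2t)\<close> and \<open>2 b w\<^sup>* + s v = (a\<^sup>* - \<gamma>) w\<close>.\<close>

lemma jacobi_e_Je:
  "2 * (w1 * w1 + w2 * w2) = s * (1 - 2 * t)"
  "2 * (b1 * w1 + b2 * w2) + s * v1 = ((1 - t) / 2 - \<gamma>) * w1 + \<tau> * w2"
  "2 * (b2 * w1 - b1 * w2) + s * v2 = ((1 - t) / 2 - \<gamma>) * w2 - \<tau> * w1"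
proof -
  note J = jacobi[of "J f" e "J e"]
  show "2 * (w1 * w1 + w2 * w2) = s * (1 - 2 * t)"
    using arg_cong[OF J, of c3] by (simp add: jacobi_expand) (simp add: algebra_simps)
  show "2 * (b1 * w1 + b2 * w2) + s * v1 = ((1 - t) / 2 - \<gamma>) * w1 + \<tau> * w2"
    using arg_cong[OF J, of c1] by (simp add: jacobi_expand) (simp add: field_simps)
  show "2 * (b2 * w1 - b1 * w2) + s * v2 = ((1 - t) / 2 - \<gamma>) * w2 - \<tau> * w1"
    using arg_cong[OF J, of c2] by (simp add: jacobi_expand) (simp add: field_simps)
qed

text \<open>In complex notation: \<open>2\<bar>b\<bar>\<^sup>2 + Re (w\<^sup>* v) = t \<gamma>\<close> and \<open>(2\<tau> + i (t - 2\<gamma>)) b = i w v\<close>. These are the parts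
  of the identity for \<open>Jf, f, x\<close> in \<open>D\<close> that are complex linear and complex antilinear in \<open>x\<close>.\<close>

lemma jacobi_f:
  "2 * (b1 * b1 + b2 * b2) + w1 * v1 + w2 * v2 = t * \<gamma>"
  "2 * \<tau> * b1 - (t - 2 * \<gamma>) * b2 = - (w1 * v2 + w2 * v1)"
  "2 * \<tau> * b2 + (t - 2 * \<gamma>) * b1 = w1 * v1 - w2 * v2"
proof -
  note J = jacobi[of "J f" f e] and K = jacobi[of "J f" f "J e"]
  note eqs = arg_cong[OF J, of c1] arg_cong[OF J, of c2] arg_cong[OF K, of c1] arg_cong[OF K, of c2]
  show "2 * (b1 * b1 + b2 * b2) + w1 * v1 + w2 * v2 = t * \<gamma>"
    using eqs by (simp add: jacobi_expand) (simp add: field_simps)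
  show "2 * \<tau> * b1 - (t - 2 * \<gamma>) * b2 = - (w1 * v2 + w2 * v1)"
    using eqs by (simp add: jacobi_expand) (simp add: field_simps)
  show "2 * \<tau> * b2 + (t - 2 * \<gamma>) * b1 = w1 * v1 - w2 * v2"
    using eqs by (simp add: jacobi_expand) (simp add: field_simps)
qed

text \<open>Let \<open>s \<noteq> 0\<close>, so that \<open>t = - 2\<gamma> - 1\<close>. Multiplying \<open>2 b w\<^sup>* + s v = (1 - i\<tau>) w\<close> by \<open>w\<close> and inserting
  the other equations gives \<open>(1 - i\<tau>)(2 s b - w\<^sup>2) = 0\<close>, hence \<open>2 s b = w\<^sup>2\<close>. With this and the product of
  the same equation with \<open>w\<^sup>*\<close>, the equation \<open>2\<bar>b\<bar>\<^sup>2 + Re (w\<^sup>* v) = - (2\<gamma> + 1) \<gamma>\<close>, multiplied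
  by \<open>s\<^sup>2\<close>, collapses to \<open>s\<^sup>2 = 0\<close>. (If \<open>w\<close> were removed by moving \<open>f\<close>, the first equation would give
  \<open>\<gamma> = - 3/4\<close>, and then \<open>2\<bar>b\<bar>\<^sup>2 = - 3/8\<close>.)\<close>

lemma s_zero: "s = 0"
proof (rule ccontr)
  assume s: "s \<noteq> 0"
  with eta_cases have t: "t = - 2 * \<gamma> - 1" by blast
  define n where "n = w1 * w1 + w2 * w2"
  have n: "2 * n = s * (3 + 4 * \<gamma>)" using jacobi_e_Je(1) by (simp add: n_def t algebra_simps)
  have D: "2 * (b1 * w1 + b2 * w2) + s * v1 = w1 + \<tau> * w2"
    "2 * (b2 * w1 - b1 * w2) + s * v2 = w2 - \<tau> * w1"
    using jacobi_e_Je(2,3) by (simp_all add: t field_simps)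
  have F: "2 * \<tau> * b1 + (4 * \<gamma> + 1) * b2 = - (w1 * v2 + w2 * v1)"
    "2 * \<tau> * b2 - (4 * \<gamma> + 1) * b1 = w1 * v1 - w2 * v2"
    using jacobi_f(2,3) by (simp_all add: t algebra_simps)
  \<comment> \<open>\<open>p + i q = 2 s b - w\<^sup>2\<close>\<close>
  define p where "p = 2 * s * b1 - (w1 * w1 - w2 * w2)"
  define q where "q = 2 * s * b2 - 2 * w1 * w2"
  have pq: "p + \<tau> * q = 0" "q - \<tau> * p = 0"
    using D F n unfolding p_def q_def n_def by algebra+
  have "(1 + \<tau> * \<tau>) * p = 0" using pq by algebra
  moreover have "1 + \<tau> * \<tau> \<noteq> 0" by (smt (verit) zero_le_square)
  ultimately have p: "p = 0" by simp
  with pq have q: "q = 0" by simp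
  have G: "2 * (b1 * b1 + b2 * b2) + w1 * v1 + w2 * v2 = - (2 * \<gamma> + 1) * \<gamma>"
    using jacobi_f(1) by (simp add: t algebra_simps)
  have "s * s * 3 = 0"
    using D G n p q unfolding p_def q_def n_def by algebra
  with s show False by simp
qed

lemma w_zero: "w1 = 0" "w2 = 0"
proof -
  have "w1 * w1 + w2 * w2 = 0" using jacobi_e_Je(1) s_zero by algebra
  then show "w1 = 0" "w2 = 0" by (simp_all add: sum_squares_eq_zero_iff)
qed

text \<open>\<open>1 - t\<close> is the trace of \<open>ad\<^bsub>Jf\<^esub>\<close> on \<open>D\<close>; its positivity makes \<open>D\<close> isotropic in the next lemma. For
  \<open>t = - 2\<gamma> - 1\<close> the Jacobi identity \<open>2\<bar>b\<bar>\<^sup>2 = - (2\<gamma> + 1) \<gamma>\<close> confines \<open>\<gamma>\<close> to \<open>[- 1/2, 0]\<close>.\<close>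

lemma t_lt_one: "t < 1"
proof (cases "t = 0")
  case False
  then have t: "t = - 2 * \<gamma> - 1" using eta_cases by blast
  have "0 \<le> 2 * (b1 * b1 + b2 * b2)" by simp
  also have "\<dots> = - ((2 * \<gamma> + 1) * \<gamma>)"
    using jacobi_f(1) by (simp add: w_zero t algebra_simps)
  finally have "(2 * \<gamma> + 1) * \<gamma> \<le> 0" by simp
  then have "\<gamma> > - 1" by (smt (verit) mult_neg_neg)
  with t show ?thesis by simp
qed simp

lemma omega_D_zero: "\<omega> e (J e) = 0"
proof -
  have "(1 - t) * \<omega> e (J e) = 0"
    using omega_closed[of "J f" e "J e"] omega_skew[of "J e" e]
    by (simp add: br_skew[of "J e" "J f"] bracket_table s_zero w_zero omega_simps omega_self field_simps)
  with t_lt_one show ?thesis by simp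
qed

text \<open>With \<open>h = (1 + t)/2 - \<gamma>\<close>, closedness on \<open>f, Jf, x\<close> reads \<open>\<omega>(f, (h + i\<tau>) x + 2 b x\<^sup>*) = 0\<close> for all \<open>x\<close>
  in \<open>D\<close>. As \<open>D\<close> is isotropic and \<open>\<omega>\<close> nondegenerate, \<open>\<omega>(f, \<cdot>)\<close> is nonzero on \<open>D\<close>; so the real linear
  map \<open>x \<mapsto> (h + i\<tau>) x + 2 b x\<^sup>*\<close> is singular, and its determinant is \<open>\<bar>h + i\<tau>\<bar>\<^sup>2 - 4\<bar>b\<bar>\<^sup>2\<close>.\<close>

lemma kaehler_equation: "((1 + t) / 2 - \<gamma>)\<^sup>2 + \<tau>\<^sup>2 = 4 * (b1 * b1 + b2 * b2)"
proof -
  define h where "h = (1 + t) / 2 - \<gamma>"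
  define m1 m2 where "m1 = \<omega> f e" and "m2 = \<omega> f (J e)"
  have m2: "\<omega> e (J f) = \<omega> f (J e)" using omega_J_left[of e f] omega_skew[of "J e" f] by simp
  note simps = br_skew[of e f] br_skew[of "J e" f] br_skew[of f "J f"] bracket_table s_zero w_zero omega_simps
    omega_self omega_D_zero omega_skew[of "J e" e] omega_skew[of e f] omega_skew[of "J e" f] omega_J_left J_simps m2
  have A: "(h + 2 * b1) * m1 + (\<tau> + 2 * b2) * m2 = 0"
    using omega_closed[of f "J f" e] by (simp add: simps) (simp add: h_def m1_def m2_def field_simps)
  have B: "(2 * b2 - \<tau>) * m1 + (h - 2 * b1) * m2 = 0"
    using omega_closed[of f "J f" "J e"] by (simp add: simps) (simp add: h_def m1_def m2_def field_simps)
  have "m1 \<noteq> 0 \<or> m2 \<noteq> 0"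
  proof (rule ccontr)
    assume "\<not> ?thesis"
    then have m: "\<omega> f e = 0" "\<omega> f (J e) = 0" by (auto simp: m1_def m2_def)
    have "\<omega> e y = 0" for y
    proof -
      have "\<omega> e y = \<omega> e (c1 y *\<^sub>R e + c2 y *\<^sub>R J e + c3 y *\<^sub>R f + c4 y *\<^sub>R J f)"
        using coord_expand[of y] by simp
      also have "\<dots> = 0"
        using m omega_J_left[of e f] omega_skew[of "J e" f] omega_skew[of e f]
        by (simp add: omega_simps omega_self omega_D_zero)
      finally show ?thesis .
    qed
    then have "e = 0" by (rule omega_nondegenerate)
    with frame_nonzero show False by simp
  qed
  moreover have "((h + 2 * b1) * (h - 2 * b1) - (\<tau> + 2 * b2) * (2 * b2 - \<tau>)) * m1 = 0"
    "((h + 2 * b1) * (h - 2 * b1) - (\<tau> + 2 * b2) * (2 * b2 - \<tau>)) * m2 = 0"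
    using A B by algebra+
  ultimately have "(h + 2 * b1) * (h - 2 * b1) - (\<tau> + 2 * b2) * (2 * b2 - \<tau>) = 0" by auto
  then show ?thesis unfolding h_def[symmetric] by (simp add: algebra_simps power2_eq_square)
qed

text \<open>For \<open>t = 0\<close> the Jacobi identity gives \<open>b = 0\<close>. Otherwise \<open>t = - 2\<gamma> - 1\<close>, so \<open>h = - 2\<gamma>\<close> and
  \<open>(2\<tau> - i (4\<gamma> + 1)) b = 0\<close>: either \<open>b\<close> vanishes, or \<open>\<tau>\<close> and \<open>4\<gamma> + 1\<close> do.\<close>

lemma parameter_cases:
  obtains (aff) "t = 0" "\<gamma> = 1/2" "\<tau> = 0" "b1 = 0" "b2 = 0"
  | (r4) "t = - 1" "\<gamma> = 0" "\<tau> = 0" "b1 = 0" "b2 = 0"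
  | (d42) "t = - 1/2" "\<gamma> = - 1/4" "\<tau> = 0" "16 * (b1 * b1 + b2 * b2) = 1"
proof (cases "t = 0")
  case True
  then have b: "b1 * b1 + b2 * b2 = 0" using jacobi_f(1) w_zero by algebra
  then have "(1/2 - \<gamma>)\<^sup>2 + \<tau>\<^sup>2 = 0" using kaehler_equation True by simp
  with True b show ?thesis by (intro aff) (simp_all add: sum_squares_eq_zero_iff sum_power2_eq_zero_iff)
next
  case False
  then have t: "t = - 2 * \<gamma> - 1" using eta_cases by blast
  have 1: "2 * (b1 * b1 + b2 * b2) = - ((2 * \<gamma> + 1) * \<gamma>)"
    using jacobi_f(1) by (simp add: w_zero t algebra_simps)
  have 2: "2 * \<tau> * b1 + (4 * \<gamma> + 1) * b2 = 0" "2 * \<tau> * b2 - (4 * \<gamma> + 1) * b1 = 0"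
    using jacobi_f(2,3) by (simp_all add: w_zero t algebra_simps)
  have 3: "4 * \<gamma>\<^sup>2 + \<tau>\<^sup>2 = 4 * (b1 * b1 + b2 * b2)"
    using kaehler_equation by (simp add: t power2_eq_square field_simps)
  show ?thesis
  proof (cases "b1 * b1 + b2 * b2 = 0")
    case True
    with 3 have "(2 * \<gamma>) * (2 * \<gamma>) + \<tau> * \<tau> = 0" by (simp add: power2_eq_square)
    then have "\<gamma> = 0" "\<tau> = 0" unfolding sum_squares_eq_zero_iff by simp_all
    with True t show ?thesis by (intro r4) (simp_all add: sum_squares_eq_zero_iff)
  next
    case False
    have "\<tau> * (b1 * b1 + b2 * b2) = 0" "(4 * \<gamma> + 1) * (b1 * b1 + b2 * b2) = 0"
      using 2 by algebra+
    with False have "\<tau> = 0" "\<gamma> = - 1/4" by auto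
    with t 1 show ?thesis by (intro d42) auto
  qed
qed

lemma classification:
  "equivalent_complex br J r4_bracket r4_J \<or> equivalent_complex br J d42_bracket d42_J1 \<or>
   equivalent_complex br J aff_bracket aff_J2"
proof (cases rule: parameter_cases)
  case aff
  \<comment> \<open>\<open>[Jf,d] - [f,Jd] = d\<close> for \<open>d\<close> in \<open>D\<close>, so moving \<open>f\<close> by \<open>- v\<close> removes \<open>v\<close>.\<close>
  define f' where "f' = f - (v1 *\<^sub>R e + v2 *\<^sub>R J e)"
  interpret new: kaehler_frame br J \<omega> e f'
    by (intro kaehler_frame.intro kaehler4_axioms frame not_in_line)
      (simp_all add: f'_def frame_nonzero)
  have "equivalent_complex br J aff_bracket aff_J2"
    by (rule new.equivalent_aff; rule coord_eqI; simp add: f'_def J_simps jacobi_expand s_zero w_zero aff)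
  then show ?thesis by blast
next
  case r4
  \<comment> \<open>Moving \<open>f\<close> by \<open>d\<close> changes \<open>v\<close> by \<open>[Jf,d] - [f,Jd] - t d = 2 d\<close>.\<close>
  define f' where "f' = f - (v1 / 2) *\<^sub>R e - (v2 / 2) *\<^sub>R J e"
  interpret new: kaehler_frame br J \<omega> e f'
    by (intro kaehler_frame.intro kaehler4_axioms frame not_in_line)
      (simp_all add: f'_def frame_nonzero)
  have "equivalent_complex br J r4_bracket r4_J"
    by (rule new.equivalent_r4; rule coord_eqI; simp add: f'_def J_simps jacobi_expand s_zero w_zero r4)
  then show ?thesis by blast
next
  case d42
  \<comment> \<open>The antilinear part \<open>x \<mapsto> b x\<^sup>*\<close> becomes \<open>x \<mapsto> x\<^sup>* / 4\<close> with respect to the unit vector \<open>u\<close> of \<open>D\<close> with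
      \<open>u\<^sup>2 = 4b\<close>.\<close>
  define u where "u = csqrt (Complex (4 * b1) (4 * b2))"
  define u1 u2 where "u1 = Re u" and "u2 = Im u"
  have "u * u = Complex (4 * b1) (4 * b2)" using power2_csqrt by (simp add: u_def power2_eq_square)
  then have b: "b1 = (u1 * u1 - u2 * u2) / 4" "b2 = u1 * u2 / 2"
    by (auto simp: complex_eq_iff u1_def u2_def algebra_simps)
  have "(u1 * u1 + u2 * u2)\<^sup>2 = 16 * (b1 * b1 + b2 * b2)"
    unfolding b by (simp add: power2_eq_square field_simps)
  then have "(u1 * u1 + u2 * u2)\<^sup>2 = 1" using d42 by simp
  then have n: "u1 * u1 + u2 * u2 = 1"
    by (simp add: power2_eq_1_iff) (smt (verit) zero_le_square)
  define e' where "e' = u1 *\<^sub>R e + u2 *\<^sub>R J e"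
  \<comment> \<open>The coordinates of \<open>v\<close> in the rotated frame.\<close>
  define x1 x2 where "x1 = v1 * u1 + v2 * u2" and "x2 = v2 * u1 - v1 * u2"
  note table = jacobi_expand s_zero w_zero d42(1-3) J_simps
  have T1: "br e' (J e') = 0"
    by (simp add: e'_def table)
  have T2: "br f e' = - (1/2) *\<^sub>R J e'"
    using n b by (intro coord_eqI; simp add: e'_def table; algebra)
  have T3: "br f (J e') = 0"
    using n b by (intro coord_eqI; simp add: e'_def table; algebra)
  have T4: "br (J f) e' = e'"
    using n b by (intro coord_eqI; simp add: e'_def table; algebra)
  have T5: "br (J f) (J e') = (1/2) *\<^sub>R J e'"
    using n b by (intro coord_eqI; simp add: e'_def table; algebra)
  have T6: "br (J f) f = x1 *\<^sub>R e' + x2 *\<^sub>R J e' - (1/2) *\<^sub>R f"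
    using n b by (intro coord_eqI; simp add: e'_def table x1_def x2_def; algebra)
  \<comment> \<open>Moving \<open>f\<close> by \<open>d\<close> multiplies the two coordinates of \<open>d\<close> by \<open>3/2\<close> and \<open>1/2\<close> before adding them to
      those of \<open>v\<close>.\<close>
  define f' where "f' = f - (2 * x1 / 3) *\<^sub>R e' - (2 * x2) *\<^sub>R J e'"
  have "e' \<noteq> 0"
  proof
    assume "e' = 0"
    then have "c1 e' = 0" "c2 e' = 0" by simp_all
    with n show False by (simp add: e'_def)
  qed
  interpret new: kaehler_frame br J \<omega> e' f'
    by (intro kaehler_frame.intro kaehler4_axioms frame not_in_line \<open>e' \<noteq> 0\<close>)
      (simp_all add: f'_def e'_def)
  have "equivalent_complex br J d42_bracket d42_J1"
    by (rule new.equivalent_d42; rule coord_eqI; simp add: f'_def J_simps br_simps br_self T1 T2 T3 T4 T5 T6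
        br_skew[of e' f] br_skew[of "J e'" f] br_skew[of e' "J f"] br_skew[of "J e'" e']; simp add: field_simps)
  then show ?thesis by blast
qed

end

context kaehler4
begin

text \<open>If \<open>\<xi>\<close> is nonzero then \<open>\<xi>\<close> and \<open>\<xi> \<circ> J\<close> are linearly independent, since \<open>J\<close> has no real eigenvalue;
  so both may be prescribed, first at \<open>f\<close> and then, after subtracting a combination of \<open>f\<close> and \<open>Jf\<close>, at
  any vector outside the complex line of \<open>f\<close>.\<close>

lemma exists_adapted_frame:
  assumes "\<not> unimodular br" and rf: "ricci_flat br g"
  shows "\<exists>e f. adapted_frame br J \<omega> e f"
proof -
  define \<xi> where "\<xi> x = lin_trace (br x)" for x
  have lin: "linear \<xi>" unfolding \<xi>_def by (rule linear_trace_ad)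
  note \<xi>_simps = linear_add[OF lin] linear_diff[OF lin] linear_neg[OF lin] linear_cmul[OF lin]
  obtain h0 where h0: "\<xi> h0 \<noteq> 0" using assms by (auto simp: unimodular_def \<xi>_def)
  define n where "n = \<xi> h0 * \<xi> h0 + \<xi> (J h0) * \<xi> (J h0)"
  have n: "n \<noteq> 0" using h0 by (simp add: n_def sum_squares_eq_zero_iff)
  define f where "f = (1 / n) *\<^sub>R (\<xi> (J h0) *\<^sub>R h0 - \<xi> h0 *\<^sub>R J h0)"
  have f: "\<xi> f = 0" "\<xi> (J f) = 1"
    using n by (simp_all add: f_def \<xi>_simps J_simps) (simp add: n_def field_simps)
  obtain y where y: "y \<notin> span {f, J f}" using exists_outside_complex_line[OF dim4] by blast
  define e where "e = y - \<xi> y *\<^sub>R J f - \<xi> (J y) *\<^sub>R f"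
  have e: "\<xi> e = 0" "\<xi> (J e) = 0" using f by (simp_all add: e_def \<xi>_simps J_simps)
  have "e \<noteq> 0"
  proof
    assume "e = 0"
    then have "y = \<xi> y *\<^sub>R J f + \<xi> (J y) *\<^sub>R f" by (simp add: e_def algebra_simps)
    moreover have "\<dots> \<in> span {f, J f}" by (intro span_add span_scale) (auto intro: span_base)
    ultimately show False using y by simp
  qed
  moreover have "f \<notin> span {e, J e}"
  proof
    assume "f \<in> span {e, J e}"
    then obtain a b where "f - a *\<^sub>R e = b *\<^sub>R J e" by (auto simp: span_breakdown_eq span_singleton)
    then have "f = a *\<^sub>R e + b *\<^sub>R J e" by (simp add: algebra_simps)
    then have "\<xi> (J f) = 0" by (simp add: \<xi>_simps J_simps e)
    with f show False by simp
  qed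
  ultimately interpret kaehler_frame br J \<omega> e f
    by (intro kaehler_frame.intro kaehler4_axioms frame)
  have "adapted_frame br J \<omega> e f"
    using e f ricci_flat_eta[OF rf] by unfold_locales (simp_all add: \<xi>_def)
  then show ?thesis by blast
qed

end

section \<open>Flat and Ricci-flat metrics on the models\<close>

text \<open>The Ricci tensor at \<open>x, y\<close> is minus the trace of the rank one map \<open>v \<mapsto> k \<phi>(x,v) N y\<close>, that is
  \<open>- k \<phi>(x, N y)\<close>. The parameter values 0 and 1 give the two metrics.\<close>

lemma flat_and_ricci_flat_metrics:
  fixes br :: "'a::real_vector \<Rightarrow> 'a \<Rightarrow> 'a" and \<Omega> :: "real \<Rightarrow> 'a \<Rightarrow> 'a \<Rightarrow> real"
  assumes k4: "\<And>k. kaehler4 br J (\<Omega> k)"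
    and curv: "\<And>k x y z. curvature br (\<lambda>x y. \<Omega> k (J x) y) x y z = (k * \<phi> x y) *\<^sub>R N z"
    and lin: "\<And>x. linear (\<phi> x)" and null: "\<And>x y. \<phi> x (N y) = 0"
    and nonzero: "\<phi> a b \<noteq> 0" "N c \<noteq> 0"
  shows "(\<exists>g. pseudo_kaehler_metric br J g \<and> flat br g) \<and>
         (\<exists>g. pseudo_kaehler_metric br J g \<and> ricci_flat br g \<and> \<not> flat br g)"
proof -
  let ?g = "\<lambda>k x y. \<Omega> k (J x) y"
  have pk: "pseudo_kaehler_metric br J (?g k)" for k
    using kaehler4.kaehler[OF k4] by (auto simp: pseudo_kaehler_metric_def)
  have "flat br (?g 0)" by (simp add: flat_def curv)
  moreover have "\<not> flat br (?g 1)" using nonzero by (auto simp: flat_def curv)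
  moreover have "ricci_flat br (?g 1)"
  proof -
    obtain B :: "'a set" where "is_basis B" using kaehler4.exists_basis[OF k4] by blast
    then show ?thesis
      by (simp add: ricci_flat_def kaehler4.ricci_eq_trace[OF k4] curv lin_trace_rank_one lin null)
  qed
  ultimately show ?thesis using pk by blast
qed

lemma linear_wedge: "linear (wedge i j x)"
  by (rule linearI) (simp_all add: wedge_def algebra_simps)

lemmas coordinate_simps = model_defs vec_eq_iff forall_4 wedge_def ee_def axis_def

text \<open>In the frames of the classification, \<open>D\<close> is isotropic and the value of \<open>\<omega>\<close> on the line of \<open>f\<close> is
  free: this is the coefficient \<open>k\<close>. The vector given for \<open>\<nabla>\<^sub>x y\<close> solves the Koszul formula. The same
  holds for the other two models.\<close>

lemma r4_metrics:
  "(\<exists>g. pseudo_kaehler_metric r4_bracket r4_J g \<and> flat r4_bracket g) \<and>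
   (\<exists>g. pseudo_kaehler_metric r4_bracket r4_J g \<and> ricci_flat r4_bracket g \<and> \<not> flat r4_bracket g)"
proof -
  define \<Omega> where "\<Omega> k x y = wedge 1 2 x y + wedge 3 4 x y + k * wedge 1 4 x y"
    for k :: real and x y :: "real^4"
  define N where "N z = (3 * z$1) *\<^sub>R ee 2 - (3 * z$4) *\<^sub>R ee 3" for z :: "real^4"
  have k4: "kaehler4 r4_bracket r4_J (\<Omega> k)" for k
  proof (rule kaehler4.intro)
    have "x = 0" if "\<forall>y. \<Omega> k x y = 0" for x
      using that[rule_format, of "ee 1"] that[rule_format, of "ee 2"] that[rule_format, of "ee 3"]
        that[rule_format, of "ee 4"]
      by (simp add: \<Omega>_def coordinate_simps)
    then show "kaehler_lie_algebra r4_bracket r4_J (\<Omega> k)"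
      unfolding kaehler_lie_algebra_def nondegenerate_def
      by (auto simp: lie_algebra_models complex_structure_models two_form_def closed_form_def bilinear_def
          \<Omega>_def coordinate_simps algebra_simps intro!: linearI)
  qed simp
  have nabla: "levi_civita r4_bracket (\<lambda>x y. \<Omega> k (r4_J x) y) x y = vector [x$4 * y$1,
      k * x$1 * y$1 - x$4 * y$2 - k * x$4 * y$4, - k * x$1 * y$4 - k * x$4 * y$1 - x$4 * y$3, x$4 * y$4]"
    for k x y
    by (rule kaehler4.levi_civita_eqI[OF k4]) (simp add: \<Omega>_def coordinate_simps algebra_simps)
  have "curvature r4_bracket (\<lambda>x y. \<Omega> k (r4_J x) y) x y z = (k * wedge 1 4 x y) *\<^sub>R N z" for k x y z
    unfolding curvature_def Let_def nabla by (simp add: N_def coordinate_simps algebra_simps)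
  then show ?thesis
    by (rule flat_and_ricci_flat_metrics[OF k4 _ linear_wedge, where a = "ee 1" and b = "ee 4" and c = "ee 1"])
      (simp_all add: N_def coordinate_simps)
qed

lemma d42_metrics:
  "(\<exists>g. pseudo_kaehler_metric d42_bracket d42_J1 g \<and> flat d42_bracket g) \<and>
   (\<exists>g. pseudo_kaehler_metric d42_bracket d42_J1 g \<and> ricci_flat d42_bracket g \<and> \<not> flat d42_bracket g)"
proof -
  define \<Omega> where "\<Omega> k x y = wedge 1 4 x y + wedge 2 3 x y + k * wedge 2 4 x y"
    for k :: real and x y :: "real^4"
  define N where "N z = (3 * z$2) *\<^sub>R ee 3 - (3 * z$4) *\<^sub>R ee 1" for z :: "real^4"
  have k4: "kaehler4 d42_bracket d42_J1 (\<Omega> k)" for k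
  proof (rule kaehler4.intro)
    have "x = 0" if "\<forall>y. \<Omega> k x y = 0" for x
      using that[rule_format, of "ee 1"] that[rule_format, of "ee 2"] that[rule_format, of "ee 3"]
        that[rule_format, of "ee 4"]
      by (simp add: \<Omega>_def coordinate_simps)
    then show "kaehler_lie_algebra d42_bracket d42_J1 (\<Omega> k)"
      unfolding kaehler_lie_algebra_def nondegenerate_def
      by (auto simp: lie_algebra_models complex_structure_models two_form_def closed_form_def bilinear_def
          \<Omega>_def coordinate_simps algebra_simps intro!: linearI)
  qed simp
  have nabla: "levi_civita d42_bracket (\<lambda>x y. \<Omega> k (d42_J1 x) y) x y = vector [
      - x$1 * y$4 + k * x$2 * y$4 + x$4 * y$1 + k * x$4 * y$2, - x$4 * y$2,
      x$1 * y$2 - k * x$2 * y$2 + x$4 * y$3 + k * x$4 * y$4, - x$4 * y$4]"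
    for k x y
    by (rule kaehler4.levi_civita_eqI[OF k4]) (simp add: \<Omega>_def coordinate_simps algebra_simps)
  have "curvature d42_bracket (\<lambda>x y. \<Omega> k (d42_J1 x) y) x y z = (k * wedge 2 4 x y) *\<^sub>R N z" for k x y z
    unfolding curvature_def Let_def nabla by (simp add: N_def coordinate_simps algebra_simps)
  then show ?thesis
    by (rule flat_and_ricci_flat_metrics[OF k4 _ linear_wedge, where a = "ee 2" and b = "ee 4" and c = "ee 2"])
      (simp_all add: N_def coordinate_simps)
qed

lemma aff_metrics:
  "(\<exists>g. pseudo_kaehler_metric aff_bracket aff_J2 g \<and> flat aff_bracket g) \<and>
   (\<exists>g. pseudo_kaehler_metric aff_bracket aff_J2 g \<and> ricci_flat aff_bracket g \<and> \<not> flat aff_bracket g)"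
proof -
  define \<Omega> where "\<Omega> k x y = wedge 1 4 x y + wedge 2 3 x y + k * wedge 1 2 x y"
    for k :: real and x y :: "real^4"
  define N where "N z = (2 * z$1) *\<^sub>R ee 4 + (2 * z$2) *\<^sub>R ee 3" for z :: "real^4"
  have k4: "kaehler4 aff_bracket aff_J2 (\<Omega> k)" for k
  proof (rule kaehler4.intro)
    have "x = 0" if "\<forall>y. \<Omega> k x y = 0" for x
      using that[rule_format, of "ee 1"] that[rule_format, of "ee 2"] that[rule_format, of "ee 3"]
        that[rule_format, of "ee 4"]
      by (simp add: \<Omega>_def coordinate_simps)
    then show "kaehler_lie_algebra aff_bracket aff_J2 (\<Omega> k)"
      unfolding kaehler_lie_algebra_def nondegenerate_def
      by (auto simp: lie_algebra_models complex_structure_models two_form_def closed_form_def bilinear_def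
          \<Omega>_def coordinate_simps algebra_simps intro!: linearI)
  qed simp
  have nabla: "levi_civita aff_bracket (\<lambda>x y. \<Omega> k (aff_J2 x) y) x y = vector [
      - x$1 * y$1 + x$2 * y$2, - x$1 * y$2 - x$2 * y$1,
      - k * x$1 * y$1 + x$1 * y$3 + k * x$2 * y$2 - x$2 * y$4,
      k * x$1 * y$2 + x$1 * y$4 + k * x$2 * y$1 + x$2 * y$3]"
    for k x y
    by (rule kaehler4.levi_civita_eqI[OF k4]) (simp add: \<Omega>_def coordinate_simps algebra_simps)
  have "curvature aff_bracket (\<lambda>x y. \<Omega> k (aff_J2 x) y) x y z = (k * wedge 1 2 x y) *\<^sub>R N z" for k x y z
    unfolding curvature_def Let_def nabla by (simp add: N_def coordinate_simps algebra_simps)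
  then show ?thesis
    by (rule flat_and_ricci_flat_metrics[OF k4 _ linear_wedge, where a = "ee 1" and b = "ee 2" and c = "ee 1"])
      (simp_all add: N_def coordinate_simps)
qed

section \<open>The classification theorem\<close>

theorem theorem4p6:
  shows "(\<forall>(br :: 'a::real_vector \<Rightarrow> 'a \<Rightarrow> 'a) J g.
            dim (UNIV :: 'a set) = 4 \<and> \<not> unimodular br \<and>
            pseudo_kaehler_metric br J g \<and> ricci_flat br g \<longrightarrow>
              equivalent_complex br J r4_bracket r4_J \<or>
              equivalent_complex br J d42_bracket d42_J1 \<or>
              equivalent_complex br J aff_bracket aff_J2)
       \<and> (\<forall>(br, J) \<in> {(r4_bracket, r4_J), (d42_bracket, d42_J1), (aff_bracket, aff_J2)}.
            (\<exists>g. pseudo_kaehler_metric br J g \<and> flat br g) \<and>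
            (\<exists>g. pseudo_kaehler_metric br J g \<and> ricci_flat br g \<and> \<not> flat br g))"
proof (intro conjI allI impI)
  fix br :: "'a \<Rightarrow> 'a \<Rightarrow> 'a" and J :: "'a \<Rightarrow> 'a" and g :: "'a \<Rightarrow> 'a \<Rightarrow> real"
  assume A: "dim (UNIV :: 'a set) = 4 \<and> \<not> unimodular br \<and> pseudo_kaehler_metric br J g \<and> ricci_flat br g"
  then obtain \<omega> where \<omega>: "kaehler_lie_algebra br J \<omega>" "g = (\<lambda>x y. \<omega> (J x) y)"
    by (auto simp: pseudo_kaehler_metric_def)
  with A have "kaehler4 br J \<omega>" by (simp add: kaehler4_def)
  then obtain e f where "adapted_frame br J \<omega> e f"
    using kaehler4.exists_adapted_frame A \<omega>(2) by blast
  then show "equivalent_complex br J r4_bracket r4_J \<or> equivalent_complex br J d42_bracket d42_J1 \<or>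
      equivalent_complex br J aff_bracket aff_J2"
    by (rule adapted_frame.classification)
next
  show "\<forall>(br, J) \<in> {(r4_bracket, r4_J), (d42_bracket, d42_J1), (aff_bracket, aff_J2)}.
            (\<exists>g. pseudo_kaehler_metric br J g \<and> flat br g) \<and>
            (\<exists>g. pseudo_kaehler_metric br J g \<and> ricci_flat br g \<and> \<not> flat br g)"
    using r4_metrics d42_metrics aff_metrics by simp
qed

end
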